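(* Let $s>\frac32$, $T>0$, and $z_0=(u_0,v_0,w_0)\in H^s(\mathbb{R})^3$. Suppose $z=(u,v,w)\in\mathcal{C}([0,T];H^s(\mathbb{R})^3)$ is the solution of the nonlocal three-component Camassa--Holm system below with initial data $z_0$. If there exists $\alpha\in(0,1)$ such that $$|u_0(x)|,|v_0(x)|,|w_0(x)|\sim\mathcal{O}(e^{\alpha x})\ \text{and}\ |u_{0x}(x)|,|v_{0x}(x)|,|w_{0x}(x)|\sim\mathcal{O}(e^{\alpha x})\quad\text{as } x\downarrow-\infty,$$ then $$|u(t,x)|,|v(t,x)|,|w(t,x)|\sim\mathcal{O}(e^{\alpha x})\ \text{and}\ |u_x(t,x)|,|v_x(t,x)|,|w_x(t,x)|\sim\mathcal{O}(e^{\alpha x})\quad\text{as } x\downarrow-\infty,$$ uniformly for $t\in[0,T]$.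
   Context: The system is $u_t+(u+v+w)u_x+G*(uv_x+uw_x)+\partial_xG*f=0$, $v_t+(u+v+w)v_x+G*(vu_x+vw_x)+\partial_xG*g=0$, $w_t+(u+v+w)w_x+G*(wu_x+wv_x)+\partial_xG*h=0$, $(u,v,w)|_{t=0}=(u_0,v_0,w_0)$, where $G(x)=\frac12e^{-|x|}$ and $f=u^2+\frac12u_x^2+u_xv_x+u_xw_x+\frac12v^2-\frac12v_x^2+\frac12w^2-\frac12w_x^2$, $g=v^2+\frac12v_x^2+u_xv_x+w_xv_x+\frac12u^2-\frac12u_x^2+\frac12w^2-\frac12w_x^2$, $h=w^2+\frac12w_x^2+u_xw_x+v_xw_x+\frac12u^2-\frac12u_x^2+\frac12v^2-\frac12v_x^2$. Notation: $F(x)\sim\mathcal{O}(e^{\alpha x})$ as $x\downarrow-\infty$ means there is $K>0$ with $\lim_{x\to-\infty}|F(x)|/e^{\alpha x}\le K$ (i.e. $|F(x)|\le Ke^{\alpha x}$ for $x$ near $-\infty$). Uniformly in $t\in[0,T]$ means the constant $K$ can be chosen independent of $t$. *)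

theory Defs
  imports "HOL-Analysis.Analysis"
begin

definition sq_integrable :: "(real \<Rightarrow> real) \<Rightarrow> bool" where
  "sq_integrable f \<longleftrightarrow> f \<in> borel_measurable lborel \<and> integrable lborel (\<lambda>x. (f x)^2)"

definition fourier_trunc :: "(real \<Rightarrow> real) \<Rightarrow> real \<Rightarrow> real \<Rightarrow> complex" where
  "fourier_trunc f R \<xi> = (LINT x:{-R..R}|lborel. complex_of_real (f x) * cis (- (x * \<xi>)))"

definition is_L2_fourier :: "(real \<Rightarrow> real) \<Rightarrow> (real \<Rightarrow> complex) \<Rightarrow> bool" where
  "is_L2_fourier f F \<longleftrightarrow> F \<in> borel_measurable lborel \<and>
     integrable lborel (\<lambda>\<xi>. (cmod (F \<xi>))^2) \<and>
     ((\<lambda>R. LINT \<xi>|lborel. (cmod (F \<xi> - fourier_trunc f R \<xi>))^2) \<longlongrightarrow> 0) at_top"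

definition in_Hs :: "real \<Rightarrow> (real \<Rightarrow> real) \<Rightarrow> bool" where
  "in_Hs s f \<longleftrightarrow> sq_integrable f \<and>
     (\<exists>F. is_L2_fourier f F \<and> integrable lborel (\<lambda>\<xi>. (1 + \<xi>^2) powr s * (cmod (F \<xi>))^2))"

definition Hs_norm :: "real \<Rightarrow> (real \<Rightarrow> real) \<Rightarrow> real" where
  "Hs_norm s f = sqrt (LINT \<xi>|lborel. (1 + \<xi>^2) powr s * (cmod ((SOME F. is_L2_fourier f F) \<xi>))^2)"

definition in_C_Hs :: "real \<Rightarrow> real \<Rightarrow> (real \<Rightarrow> real \<Rightarrow> real) \<Rightarrow> bool" where
  "in_C_Hs s T u \<longleftrightarrow> (\<forall>t\<in>{0..T}. in_Hs s (u t)) \<and>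
     (\<forall>t0\<in>{0..T}. ((\<lambda>t. Hs_norm s (\<lambda>x. u t x - u t0 x)) \<longlongrightarrow> 0) (at t0 within {0..T}))"

definition G :: "real \<Rightarrow> real" where
  "G x = exp (- \<bar>x\<bar>) / 2"

definition Gx :: "real \<Rightarrow> real" where
  "Gx x = - sgn x * exp (- \<bar>x\<bar>) / 2"

definition conv :: "(real \<Rightarrow> real) \<Rightarrow> (real \<Rightarrow> real) \<Rightarrow> real \<Rightarrow> real" where
  "conv k f x = (LINT y|lborel. k (x - y) * f y)"

text \<open>fF a b c ax bx cx; then f = fF u v w ux vx wx, g = fF v u w vx ux wx,
  h = fF w u v wx ux vx.\<close>
definition fF :: "real \<Rightarrow> real \<Rightarrow> real \<Rightarrow> real \<Rightarrow> real \<Rightarrow> real \<Rightarrow> real" where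
  "fF a b c ax bx cx = a^2 + ax^2 / 2 + ax * bx + ax * cx + b^2 / 2 - bx^2 / 2 + c^2 / 2 - cx^2 / 2"

definition CH_term :: "(real \<Rightarrow> real \<Rightarrow> real) \<Rightarrow> (real \<Rightarrow> real \<Rightarrow> real) \<Rightarrow> (real \<Rightarrow> real \<Rightarrow> real)
    \<Rightarrow> real \<Rightarrow> real \<Rightarrow> real" where
  "CH_term a b c t x =
     (a t x + b t x + c t x) * deriv (a t) x
     + conv G (\<lambda>y. a t y * deriv (b t) y + a t y * deriv (c t) y) x
     + conv Gx (\<lambda>y. fF (a t y) (b t y) (c t y) (deriv (a t) y) (deriv (b t) y) (deriv (c t) y)) x"

definition CH3_solution :: "real \<Rightarrow> (real \<Rightarrow> real \<Rightarrow> real) \<Rightarrow> (real \<Rightarrow> real \<Rightarrow> real)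
    \<Rightarrow> (real \<Rightarrow> real \<Rightarrow> real) \<Rightarrow> (real \<Rightarrow> real) \<Rightarrow> (real \<Rightarrow> real) \<Rightarrow> (real \<Rightarrow> real) \<Rightarrow> bool" where
  "CH3_solution T u v w u0 v0 w0 \<longleftrightarrow>
     u 0 = u0 \<and> v 0 = v0 \<and> w 0 = w0 \<and>
     (\<forall>t\<in>{0..T}. \<forall>x. u t differentiable at x \<and> v t differentiable at x \<and> w t differentiable at x) \<and>
     (\<forall>t\<in>{0..T}. \<forall>x.
        ((\<lambda>\<tau>. u \<tau> x) has_real_derivative (- CH_term u v w t x)) (at t within {0..T}) \<and>
        ((\<lambda>\<tau>. v \<tau> x) has_real_derivative (- CH_term v u w t x)) (at t within {0..T}) \<and>
        ((\<lambda>\<tau>. w \<tau> x) has_real_derivative (- CH_term w u v t x)) (at t within {0..T}))"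

definition exp_decay_left :: "real \<Rightarrow> (real \<Rightarrow> real) \<Rightarrow> bool" where
  "exp_decay_left \<alpha> F \<longleftrightarrow> (\<exists>K M. \<forall>x\<le>M. \<bar>F x\<bar> \<le> K * exp (\<alpha> * x))"

definition exp_decay_left_unif :: "real \<Rightarrow> real \<Rightarrow> (real \<Rightarrow> real \<Rightarrow> real) \<Rightarrow> bool" where
  "exp_decay_left_unif T \<alpha> F \<longleftrightarrow> (\<exists>K M. \<forall>t\<in>{0..T}. \<forall>x\<le>M. \<bar>F t x\<bar> \<le> K * exp (\<alpha> * x))"

end

theory Submission
  imports Defs "HOL-Probability.Characteristic_Functions"
begin

text \<open>
  Since \<open>s > 3/2\<close>, Fourier inversion bounds the solution and its \<open>x\<close>-derivatives by a constant \<open>B\<close> on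
  \<open>[0,T] \<times> \<real>\<close>. All sizes are then measured against \<open>S exp (\<mu> t) W(x)\<close> with
  \<open>W(x) = exp (\<alpha> x) + \<epsilon> exp (- \<alpha> x)\<close>: convolution with \<open>G\<close> preserves \<open>W\<close> up to the factor
  \<open>1/(1 - \<alpha>\<^sup>2)\<close>, and the \<open>\<epsilon>\<close>-term makes \<open>W\<close> grow at both ends, so that bounded functions are
  dominated by \<open>W\<close> and comparison functions attain their maxima. If \<open>S\<close> is an admissible constant,
  the nonlocal terms are bounded and Lipschitz with constants proportional to \<open>B S\<close>. Integration in
  time bounds \<open>u, v, w\<close>, and a maximum principle for \<open>a(t,x) - a(t,y)\<close> bounds the difference
  quotients, hence the derivatives. For \<open>\<mu>\<close> large depending only on \<open>B\<close> and \<open>\<alpha>\<close> this improves \<open>S\<close> to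
  \<open>2K + S/2\<close>, where \<open>K\<close> comes from the initial data. Iterating gives the constant \<open>4K\<close>, and
  \<open>\<epsilon> \<rightarrow> 0\<close> yields the claim.
\<close>

section \<open>The Fourier transform on $L^2$\<close>

text \<open>Every nonlinear term is a sum of products of two components or derivatives. One factor
  is bounded by \<open>B\<close> and only the other by the weight, so all estimates are linear in
  \<open>S\<close>. Hence \<mu> depends neither on \<open>S\<close> nor on \<epsilon>. This is
  essential: the only starting value available for \<open>S\<close> is of order 1/\<epsilon> and
  blows up in the limit, while the fixed point 4K of the improvement is free of \<epsilon>. Hence
  the detour through difference quotients. There the jump of \<open>Gx\<close> at 0 is harmless
  because it costs only the length of the interval between the two points. On the Fourier side,
  \<open>Hs_norm\<close> evaluates a transform picked by \<open>SOME\<close>, and the Bochner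
  integral of a non-integrable function is 0. So a.e. uniqueness and the square integrability of
  truncated transforms have to be established before the norm controls anything.\<close>

lemma gaussian_fourier_integral:
  fixes \<sigma> z :: real
  assumes "\<sigma> > 0"
  shows "(LINT \<xi>|lborel. complex_of_real (exp (- (\<sigma> * \<xi>)\<^sup>2 / 2)) * cis (\<xi> * z)) =
    complex_of_real (2 * pi * normal_density 0 \<sigma> z)"
proof -
  define \<phi> where "\<phi> x = std_normal_density x *\<^sub>R iexp (z / \<sigma> * x)" for x :: real
  \<comment> \<open>This is the known characteristic function of the standard normal law; the
    substitution x = \<sigma> \<xi> then produces the damping factor of width 1/\<sigma>.\<close>
  have "(LINT x|lborel. \<phi> x) = char std_normal_distribution (z / \<sigma>)"
    unfolding char_def \<phi>_def by (subst integral_density) (auto simp: normal_density_nonneg)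
  then have "complex_of_real (exp (- ((z / \<sigma>)\<^sup>2) / 2)) = \<bar>\<sigma>\<bar> *\<^sub>R (LINT \<xi>|lborel. \<phi> (\<sigma> * \<xi>))"
    using assms lborel_integral_real_affine[of \<sigma> \<phi> 0] by (simp add: char_std_normal_distribution)
  also have "(\<lambda>\<xi>. \<phi> (\<sigma> * \<xi>)) =
      (\<lambda>\<xi>. complex_of_real (1 / sqrt (2 * pi)) * (complex_of_real (exp (- (\<sigma> * \<xi>)\<^sup>2 / 2)) * cis (\<xi> * z)))"
    using assms by (auto simp: \<phi>_def std_normal_density_def cis_conv_exp scaleR_conv_of_real mult_ac)
  finally have e: "complex_of_real (exp (- ((z / \<sigma>)\<^sup>2) / 2)) = complex_of_real (\<sigma> / sqrt (2 * pi)) *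
      (LINT \<xi>|lborel. complex_of_real (exp (- (\<sigma> * \<xi>)\<^sup>2 / 2)) * cis (\<xi> * z))"
    using assms by (simp add: scaleR_conv_of_real)
  define c where "c = \<sigma> / sqrt (2 * pi)"
  have c: "c > 0" using assms by (simp add: c_def)
  have n: "2 * pi * normal_density 0 \<sigma> z = exp (- ((z / \<sigma>)\<^sup>2) / 2) / c"
    using assms real_sqrt_mult_self[of "2*pi"]
    by (simp add: normal_density_def c_def real_sqrt_mult power_divide field_simps)
  show ?thesis
    unfolding n of_real_divide e[folded c_def] using c by simp
qed

lemma integrable_gaussian:
  fixes \<sigma> :: real
  assumes "\<sigma> > 0"
  shows "integrable lborel (\<lambda>\<xi>. exp (- (\<sigma> * \<xi>)\<^sup>2 / 2))"
proof -
  have "integrable lborel (\<lambda>\<xi>. sqrt (2 * pi * (1/\<sigma>)\<^sup>2) * normal_density 0 (1/\<sigma>) \<xi>)"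
    using assms by (intro integrable_mult_right integrable_normal_density) auto
  also have "(\<lambda>\<xi>. sqrt (2 * pi * (1/\<sigma>)\<^sup>2) * normal_density 0 (1/\<sigma>) \<xi>) = (\<lambda>\<xi>. exp (- (\<sigma> * \<xi>)\<^sup>2 / 2))"
    using assms by (auto simp: normal_density_def power_divide power_mult_distrib mult.commute)
  finally show ?thesis .
qed

text \<open>Fubini for a kernel of modulus |h x| |p \<xi>|. It serves twice: with a Gaussian times a
  phase as \<open>p\<close> it gives the damped inversion formula, and with a damped conjugate
  transform as \<open>p\<close> it computes a damped L2 norm.\<close>

lemma swap_fourier_integral:
  fixes h :: "real \<Rightarrow> real" and p :: "real \<Rightarrow> complex"
  assumes h: "integrable lborel h" and p: "integrable lborel p"
  shows "(LINT \<xi>|lborel. p \<xi> * (LINT x|lborel. complex_of_real (h x) * cis (- (x * \<xi>)))) =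
    (LINT x|lborel. complex_of_real (h x) * (LINT \<xi>|lborel. p \<xi> * cis (- (x * \<xi>))))"
proof -
  have [measurable]: "h \<in> borel_measurable borel" "p \<in> borel_measurable borel"
    using h p by auto
  have [measurable]: "cis \<in> borel_measurable borel"
    by (intro borel_measurable_continuous_onI continuous_intros)
  let ?f = "\<lambda>x \<xi>. complex_of_real (h x) * (p \<xi> * cis (- (x * \<xi>)))"
  have "integrable (lborel \<Otimes>\<^sub>M lborel) (case_prod ?f)"
  proof (rule lborel_pair.Fubini_integrable)
    show "integrable lborel (\<lambda>x. LINT y|lborel. norm (case (x, y) of (x, \<xi>) \<Rightarrow> ?f x \<xi>))"
      using h p by (simp add: norm_mult)
    have "integrable lborel (\<lambda>y. ?f x y)" for x
      by (rule Bochner_Integration.integrable_bound[of _ "\<lambda>y. h x * norm (p y)"])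
         (use p in \<open>auto simp: norm_mult abs_mult\<close>)
    then show "AE x in lborel. integrable lborel (\<lambda>y. case (x, y) of (x, \<xi>) \<Rightarrow> ?f x \<xi>)" by simp
  qed (measurable)
  from lborel_pair.Fubini_integral[OF this]
  have "(LINT \<xi>|lborel. LINT x|lborel. ?f x \<xi>) = (LINT x|lborel. LINT \<xi>|lborel. ?f x \<xi>)" .
  moreover have "(LINT x|lborel. ?f x \<xi>) = p \<xi> * (LINT x|lborel. complex_of_real (h x) * cis (- (x * \<xi>)))" for \<xi>
  proof -
    have "(LINT x|lborel. ?f x \<xi>) = (LINT x|lborel. p \<xi> * (complex_of_real (h x) * cis (- (x * \<xi>))))"
      by (simp add: mult_ac)
    then show ?thesis by simp
  qed
  ultimately show ?thesis by simp
qed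

text \<open>In the non-integrable case the left side is 0 by convention, so iterated integrals can
  be bounded by Tonelli without a prior integrability check.\<close>

lemma norm_integral_le_nn_integral:
  "ennreal (norm (integral\<^sup>L M f)) \<le> (\<integral>\<^sup>+x. ennreal (norm (f x)) \<partial>M)"
  by (cases "integrable M f") (auto simp: integral_norm_bound_ennreal not_integrable_integral_eq)

lemma normal_density_swap: "normal_density x \<sigma> y = normal_density y \<sigma> x"
  by (simp add: normal_density_def power2_commute)

lemma nn_integral_normal_density:
  assumes "\<sigma> > 0"
  shows "(\<integral>\<^sup>+y. ennreal (normal_density x \<sigma> y) \<partial>lborel) = 1"
  using assms by (subst nn_integral_eq_integral) auto

text \<open>Schur's test: |h x h y| is at most half the sum of the squares, and the Gaussian kernel,
  being symmetric, has mass 1 in either variable.\<close>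

lemma mollified_quadratic_form_le:
  fixes h :: "real \<Rightarrow> real"
  assumes \<sigma>: "\<sigma> > 0" and h[measurable]: "h \<in> borel_measurable borel"
    and h2: "integrable lborel (\<lambda>x. (h x)\<^sup>2)"
  shows "\<bar>LINT x|lborel. h x * (LINT y|lborel. h y * normal_density x \<sigma> y)\<bar> \<le> (LINT x|lborel. (h x)\<^sup>2)"
proof -
  let ?k = "\<lambda>x y. normal_density x \<sigma> y"
  have [measurable]: "(\<lambda>(x, y). ?k x y) \<in> borel_measurable (borel \<Otimes>\<^sub>M borel)"
    unfolding normal_density_def by measurable
  have "ennreal \<bar>LINT x|lborel. h x * (LINT y|lborel. h y * ?k x y)\<bar>
      \<le> (\<integral>\<^sup>+x. ennreal \<bar>h x * (LINT y|lborel. h y * ?k x y)\<bar> \<partial>lborel)"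
    using norm_integral_le_nn_integral[of lborel "\<lambda>x. h x * (LINT y|lborel. h y * ?k x y)"] by simp
  also have "\<dots> \<le> (\<integral>\<^sup>+x. (\<integral>\<^sup>+y. ennreal (\<bar>h x\<bar> * \<bar>h y\<bar> * ?k x y) \<partial>lborel) \<partial>lborel)"
  proof (rule nn_integral_mono)
    fix x
    have "ennreal \<bar>h x * (LINT y|lborel. h y * ?k x y)\<bar> = ennreal \<bar>LINT y|lborel. h x * (h y * ?k x y)\<bar>"
      by simp
    also have "\<dots> \<le> (\<integral>\<^sup>+y. ennreal (norm (h x * (h y * ?k x y))) \<partial>lborel)"
      using norm_integral_le_nn_integral[of lborel "\<lambda>y. h x * (h y * ?k x y)"] by simp
    finally show "ennreal \<bar>h x * (LINT y|lborel. h y * ?k x y)\<bar>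
        \<le> (\<integral>\<^sup>+y. ennreal (\<bar>h x\<bar> * \<bar>h y\<bar> * ?k x y) \<partial>lborel)"
      by (simp add: abs_mult mult_ac)
  qed
  also have "\<dots> \<le> (\<integral>\<^sup>+x. (\<integral>\<^sup>+y. ennreal ((h x)\<^sup>2 / 2) * ennreal (?k x y) +
      ennreal ((h y)\<^sup>2 / 2) * ennreal (?k x y) \<partial>lborel) \<partial>lborel)"
  proof (intro nn_integral_mono)
    fix x y
    have "\<bar>h x\<bar> * \<bar>h y\<bar> \<le> (h x)\<^sup>2 / 2 + (h y)\<^sup>2 / 2"
      using sum_squares_bound[of "\<bar>h x\<bar>" "\<bar>h y\<bar>"] by simp
    then have "\<bar>h x\<bar> * \<bar>h y\<bar> * ?k x y \<le> ((h x)\<^sup>2 / 2 + (h y)\<^sup>2 / 2) * ?k x y"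
      by (rule mult_right_mono) simp
    also have "\<dots> = (h x)\<^sup>2 / 2 * ?k x y + (h y)\<^sup>2 / 2 * ?k x y" by (simp add: distrib_right)
    finally show "ennreal (\<bar>h x\<bar> * \<bar>h y\<bar> * ?k x y) \<le> ennreal ((h x)\<^sup>2 / 2) * ennreal (?k x y) +
      ennreal ((h y)\<^sup>2 / 2) * ennreal (?k x y)"
      by (simp add: ennreal_mult[symmetric] ennreal_plus[symmetric] ennreal_leI del: ennreal_plus)
  qed
  also have "\<dots> = (\<integral>\<^sup>+x. (\<integral>\<^sup>+y. ennreal ((h x)\<^sup>2 / 2) * ennreal (?k x y) \<partial>lborel) \<partial>lborel) +
      (\<integral>\<^sup>+x. (\<integral>\<^sup>+y. ennreal ((h y)\<^sup>2 / 2) * ennreal (?k x y) \<partial>lborel) \<partial>lborel)"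
    by (subst nn_integral_add[symmetric]) (auto intro!: nn_integral_cong nn_integral_add)
  also have "(\<integral>\<^sup>+x. (\<integral>\<^sup>+y. ennreal ((h y)\<^sup>2 / 2) * ennreal (?k x y) \<partial>lborel) \<partial>lborel) =
      (\<integral>\<^sup>+y. (\<integral>\<^sup>+x. ennreal ((h y)\<^sup>2 / 2) * ennreal (?k x y) \<partial>lborel) \<partial>lborel)"
    by (rule lborel_pair.Fubini') measurable
  also have "\<dots> = (\<integral>\<^sup>+y. ennreal ((h y)\<^sup>2 / 2) \<partial>lborel)"
    using \<sigma> by (simp add: nn_integral_cmult normal_density_swap[of _ \<sigma>] nn_integral_normal_density)
  also have "(\<integral>\<^sup>+x. (\<integral>\<^sup>+y. ennreal ((h x)\<^sup>2 / 2) * ennreal (?k x y) \<partial>lborel) \<partial>lborel) =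
      (\<integral>\<^sup>+y. ennreal ((h y)\<^sup>2 / 2) \<partial>lborel)"
    using \<sigma> by (simp add: nn_integral_cmult nn_integral_normal_density)
  also have "(\<integral>\<^sup>+y. ennreal ((h y)\<^sup>2 / 2) \<partial>lborel) = ennreal (LINT y|lborel. (h y)\<^sup>2 / 2)"
    using h2 by (intro nn_integral_eq_integral) auto
  finally have "ennreal \<bar>LINT x|lborel. h x * (LINT y|lborel. h y * ?k x y)\<bar> \<le>
      ennreal (LINT x|lborel. (h x)\<^sup>2)"
    by (simp add: ennreal_plus[symmetric] del: ennreal_plus)
  then show ?thesis by (simp add: ennreal_le_iff)
qed

lemma cis_measurable [measurable]: "cis \<in> borel_measurable borel"
  by (intro borel_measurable_continuous_onI continuous_intros)

text \<open>The inversion formula damped by a Gaussian: after Fubini the phases combine to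
  \<open>cis (\<xi> * (x - y))\<close>, and the Gaussian integral turns them into a normal density
  centred at x. Damping in frequency is thus mollification in space.\<close>

lemma gaussian_mult_fourier:
  fixes h :: "real \<Rightarrow> real"
  assumes \<sigma>: "\<sigma> > 0" and h: "integrable lborel h"
  shows "(LINT \<xi>|lborel. complex_of_real (exp (- (\<sigma> * \<xi>)\<^sup>2 / 2)) * cis (\<xi> * x) *
      (LINT y|lborel. complex_of_real (h y) * cis (- (y * \<xi>)))) =
    complex_of_real (2 * pi * (LINT y|lborel. h y * normal_density x \<sigma> y))"
proof -
  let ?g = "\<lambda>\<xi>. complex_of_real (exp (- (\<sigma> * \<xi>)\<^sup>2 / 2))"
  have "integrable lborel (\<lambda>\<xi>. ?g \<xi> * cis (\<xi> * x))"
    by (rule Bochner_Integration.integrable_bound[OF integrable_gaussian[OF \<sigma>]])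
       (auto simp: norm_mult)
  have e: "?g \<xi> * cis (\<xi> * x) * cis (- (y * \<xi>)) = ?g \<xi> * cis (\<xi> * (x - y))" for \<xi> y
    by (simp add: mult.assoc cis_mult right_diff_distrib mult.commute[of y])
  from swap_fourier_integral[OF h \<open>integrable lborel (\<lambda>\<xi>. ?g \<xi> * cis (\<xi> * x))\<close>]
  have "(LINT \<xi>|lborel. ?g \<xi> * cis (\<xi> * x) * (LINT y|lborel. complex_of_real (h y) * cis (- (y * \<xi>)))) =
    (LINT y|lborel. complex_of_real (h y) * (LINT \<xi>|lborel. ?g \<xi> * cis (\<xi> * (x - y))))"
    by (simp only: e)
  also have "\<dots> = (LINT y|lborel. complex_of_real (2 * pi * (h y * normal_density x \<sigma> y)))"
    by (subst gaussian_fourier_integral[OF \<sigma>])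
       (simp add: normal_density_def power2_commute mult_ac)
  also have "\<dots> = complex_of_real (2 * pi * (LINT y|lborel. h y * normal_density x \<sigma> y))"
    by (simp only: integral_complex_of_real integral_mult_right_zero)
  finally show ?thesis .
qed

text \<open>The inequality half of Plancherel, in qualitative form. Without it the integrals in
  \<open>is_L2_fourier\<close> could be 0 merely because the integrand is not integrable, and
  convergence of the truncations would carry no information.\<close>

lemma fourier_integral_square_integrable:
  fixes h :: "real \<Rightarrow> real"
  assumes h: "integrable lborel h" and h2: "integrable lborel (\<lambda>x. (h x)\<^sup>2)"
  shows "integrable lborel (\<lambda>\<xi>. (cmod (LINT x|lborel. complex_of_real (h x) * cis (- (x * \<xi>))))\<^sup>2)"
proof -
  have [measurable]: "h \<in> borel_measurable borel" using h by auto
  define T where "T \<xi> = (LINT x|lborel. complex_of_real (h x) * cis (- (x * \<xi>)))" for \<xi>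
  have [measurable]: "T \<in> borel_measurable borel" unfolding T_def by measurable
  have T_bound: "cmod (T \<xi>) \<le> (LINT x|lborel. \<bar>h x\<bar>)" for \<xi>
  proof -
    have "cmod (T \<xi>) \<le> (LINT x|lborel. cmod (complex_of_real (h x) * cis (- (x * \<xi>))))"
      unfolding T_def by (rule integral_norm_bound)
    then show ?thesis by (simp add: norm_mult)
  qed
  have key: "(\<integral>\<^sup>+\<xi>. ennreal (exp (- (\<sigma> * \<xi>)\<^sup>2 / 2) * (cmod (T \<xi>))\<^sup>2) \<partial>lborel) \<le>
      ennreal (2 * pi * (LINT x|lborel. (h x)\<^sup>2))" if \<sigma>: "\<sigma> > 0" for \<sigma>
  proof -
    let ?g = "\<lambda>\<xi>. exp (- (\<sigma> * \<xi>)\<^sup>2 / 2)"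
    \<comment> \<open>With the conjugate built in, \<open>p \<xi> * T \<xi>\<close> is the damped
      square of |T|, and \<open>p\<close> is integrable because \<open>T\<close> is bounded.\<close>
    define p where "p \<xi> = complex_of_real (?g \<xi>) * cnj (T \<xi>)" for \<xi>
    define b where "b = (LINT x|lborel. \<bar>h x\<bar>)"
    have b: "cmod (T \<xi>) \<le> b" for \<xi> using T_bound by (simp add: b_def)
    have [measurable]: "cnj \<in> borel_measurable borel"
      by (intro borel_measurable_continuous_onI continuous_intros)
    have [measurable]: "p \<in> borel_measurable borel" unfolding p_def by measurable
    have ip: "integrable lborel p"
      by (rule Bochner_Integration.integrable_bound[OF integrable_mult_left[OF integrable_gaussian[OF \<sigma>], of b]])
         (use b in \<open>auto simp: p_def norm_mult intro!: mult_left_mono order_trans[OF _ abs_ge_self]\<close>)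
    have ig: "integrable lborel (\<lambda>\<xi>. ?g \<xi> * (cmod (T \<xi>))\<^sup>2)"
      by (rule Bochner_Integration.integrable_bound[OF integrable_mult_left[OF integrable_gaussian[OF \<sigma>], of "b\<^sup>2"]])
         (use b in \<open>auto simp: norm_mult intro!: mult_left_mono power_mono\<close>)
    have "complex_of_real (LINT \<xi>|lborel. ?g \<xi> * (cmod (T \<xi>))\<^sup>2) = (LINT \<xi>|lborel. p \<xi> * T \<xi>)"
      by (subst integral_complex_of_real[symmetric], rule Bochner_Integration.integral_cong)
         (simp_all add: p_def complex_norm_square[unfolded of_real_power] mult_ac)
    also have "\<dots> = (LINT x|lborel. complex_of_real (h x) * (LINT \<xi>|lborel. p \<xi> * cis (- (x * \<xi>))))"
      unfolding T_def by (rule swap_fourier_integral[OF h ip])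
    also have "\<dots> = (LINT x|lborel. complex_of_real (h x * (2 * pi * (LINT y|lborel. h y * normal_density x \<sigma> y))))"
    proof (intro Bochner_Integration.integral_cong refl)
      fix x
      \<comment> \<open>Conjugation restores the phase of the damped inversion formula; its value is
        real, so the conjugate then disappears.\<close>
      have "(LINT \<xi>|lborel. p \<xi> * cis (- (x * \<xi>))) = cnj (LINT \<xi>|lborel. complex_of_real (?g \<xi>) * cis (\<xi> * x) * T \<xi>)"
        unfolding Bochner_Integration.integral_cnj[symmetric] by (simp add: p_def cis_cnj mult_ac del: Bochner_Integration.integral_cnj)
      also have "\<dots> = complex_of_real (2 * pi * (LINT y|lborel. h y * normal_density x \<sigma> y))"
        unfolding T_def by (subst gaussian_mult_fourier[OF \<sigma> h]) simp
      finally show "complex_of_real (h x) * (LINT \<xi>|lborel. p \<xi> * cis (- (x * \<xi>))) =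
        complex_of_real (h x * (2 * pi * (LINT y|lborel. h y * normal_density x \<sigma> y)))" by simp
    qed
    also have "\<dots> = complex_of_real (2 * pi * (LINT x|lborel. h x * (LINT y|lborel. h y * normal_density x \<sigma> y)))"
      by (simp only: integral_complex_of_real mult.left_commute[of _ "2*pi"] integral_mult_right_zero)
    finally have "(LINT \<xi>|lborel. ?g \<xi> * (cmod (T \<xi>))\<^sup>2) =
        2 * pi * (LINT x|lborel. h x * (LINT y|lborel. h y * normal_density x \<sigma> y))"
      by (simp only: of_real_eq_iff)
    also have "\<dots> \<le> 2 * pi * (LINT x|lborel. (h x)\<^sup>2)"
      using mollified_quadratic_form_le[OF \<sigma> _ h2] by (intro mult_left_mono) (auto simp: abs_le_iff)
    finally show ?thesis
      by (subst nn_integral_eq_integral[OF ig]) (auto intro: ennreal_leI)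
  qed
  have "(\<integral>\<^sup>+\<xi>. ennreal ((cmod (T \<xi>))\<^sup>2) \<partial>lborel) =
      (\<integral>\<^sup>+\<xi>. liminf (\<lambda>n. ennreal (exp (- (inverse (real (Suc n)) * \<xi>)\<^sup>2 / 2) * (cmod (T \<xi>))\<^sup>2)) \<partial>lborel)"
  proof (rule nn_integral_cong)
    fix \<xi> :: real
    have "(\<lambda>n. ennreal (exp (- (inverse (real (Suc n)) * \<xi>)\<^sup>2 / 2) * (cmod (T \<xi>))\<^sup>2))
        \<longlonglongrightarrow> ennreal (exp (- (0 * \<xi>)\<^sup>2 / 2) * (cmod (T \<xi>))\<^sup>2)"
      by (intro tendsto_intros tendsto_ennrealI LIMSEQ_inverse_real_of_nat) auto
    from lim_imp_Liminf[OF _ this]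
    show "ennreal ((cmod (T \<xi>))\<^sup>2) =
      liminf (\<lambda>n. ennreal (exp (- (inverse (real (Suc n)) * \<xi>)\<^sup>2 / 2) * (cmod (T \<xi>))\<^sup>2))"
      by simp
  qed
  \<comment> \<open>Fatou's lemma removes the damping, since the bound in \<open>key\<close> is
    uniform in \<sigma>.\<close>
  also have "\<dots> \<le> liminf (\<lambda>n. \<integral>\<^sup>+\<xi>. ennreal (exp (- (inverse (real (Suc n)) * \<xi>)\<^sup>2 / 2) * (cmod (T \<xi>))\<^sup>2) \<partial>lborel)"
    by (rule nn_integral_liminf) measurable
  also have "\<dots> \<le> liminf (\<lambda>n::nat. ennreal (2 * pi * (LINT x|lborel. (h x)\<^sup>2)))"
    by (intro Liminf_mono always_eventually allI key) auto
  also have "\<dots> < \<infinity>" by (simp add: Liminf_const)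
  finally have "(\<integral>\<^sup>+\<xi>. ennreal ((cmod (T \<xi>))\<^sup>2) \<partial>lborel) < \<infinity>" .
  then have "integrable lborel (\<lambda>\<xi>. (cmod (T \<xi>))\<^sup>2)"
    by (intro integrableI_nonneg) auto
  then show ?thesis by (simp add: T_def)
qed

section \<open>Truncated transforms, linearity and uniqueness of the L2 transform, and the Sobolev
  norm\<close>

lemma fourier_trunc_eq:
  "fourier_trunc f R \<xi> =
    (LINT x|lborel. complex_of_real (indicator {-R..R} x * f x) * cis (- (x * \<xi>)))"
  unfolding fourier_trunc_def set_lebesgue_integral_def
  by (simp add: scaleR_conv_of_real mult.assoc)

lemma sq_integrable_measurable: "sq_integrable f \<Longrightarrow> f \<in> borel_measurable borel"
  by (simp add: sq_integrable_def)

lemma abs_le_one_plus_square: "\<bar>x\<bar> \<le> 1 + x\<^sup>2" for x :: real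
  using sum_squares_bound[of "\<bar>x\<bar>" 1] by simp

text \<open>On a bounded interval |f| is dominated by 1 + f^2, so the truncated transform is a
  genuine L1 Fourier integral to which Fubini applies.\<close>

lemma sq_integrable_restrict:
  assumes "sq_integrable f"
  shows "integrable lborel (\<lambda>x. indicator {-R..R} x * f x)"
    and "integrable lborel (\<lambda>x. (indicator {-R..R} x * f x)\<^sup>2)"
proof -
  have [measurable]: "f \<in> borel_measurable borel" and f2: "integrable lborel (\<lambda>x. (f x)\<^sup>2)"
    using assms by (auto simp: sq_integrable_def)
  show "integrable lborel (\<lambda>x. indicator {-R..R} x * f x)"
  proof (rule Bochner_Integration.integrable_bound)
    show "integrable lborel (\<lambda>x. indicator {-R..R} x + (f x)\<^sup>2)"
      using f2 by (intro Bochner_Integration.integrable_add integrable_real_indicator)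
        (auto simp: emeasure_lborel_Icc_eq)
    show "AE x in lborel. norm (indicator {-R..R} x * f x) \<le> norm (indicator {-R..R} x + (f x)\<^sup>2)"
      by (auto simp: indicator_def abs_le_one_plus_square)
  qed measurable
  show "integrable lborel (\<lambda>x. (indicator {-R..R} x * f x)\<^sup>2)"
    by (rule Bochner_Integration.integrable_bound[OF f2]) (auto simp: indicator_def)
qed

lemma fourier_trunc_measurable:
  assumes "sq_integrable f"
  shows "fourier_trunc f R \<in> borel_measurable borel"
proof -
  have [measurable]: "f \<in> borel_measurable borel"
    using assms by (rule sq_integrable_measurable)
  show ?thesis unfolding fourier_trunc_eq[abs_def] by measurable
qed

lemma fourier_trunc_L2:
  assumes "sq_integrable f"
  shows "integrable lborel (\<lambda>\<xi>. (cmod (fourier_trunc f R \<xi>))\<^sup>2)"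
  unfolding fourier_trunc_eq
  by (intro fourier_integral_square_integrable sq_integrable_restrict assms)

lemma fourier_trunc_diff:
  assumes "sq_integrable f" "sq_integrable g"
  shows "fourier_trunc (\<lambda>x. f x - g x) R \<xi> = fourier_trunc f R \<xi> - fourier_trunc g R \<xi>"
proof -
  have *: "integrable lborel (\<lambda>x. complex_of_real (indicator {-R..R} x * f x) * cis (- (x * \<xi>)))"
    if "sq_integrable f" for f
  proof -
    have [measurable]: "f \<in> borel_measurable borel"
      using that by (rule sq_integrable_measurable)
    show ?thesis
      by (rule Bochner_Integration.integrable_bound[OF sq_integrable_restrict(1)[OF that, of R]])
        (auto simp: norm_mult)
  qed
  show ?thesis
    unfolding fourier_trunc_eq
    by (subst Bochner_Integration.integral_diff[symmetric, OF *[OF assms(1)] *[OF assms(2)]])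
      (simp add: algebra_simps)
qed

text \<open>A substitute for Minkowski's inequality in L2; the factor 2 is harmless where only
  convergence to 0 or finiteness matters.\<close>

lemma norm_diff_square_le: "(norm (a - b))\<^sup>2 \<le> 2 * (norm a)\<^sup>2 + 2 * (norm b)\<^sup>2"
  for a b :: "'a::real_normed_vector"
proof -
  have "(norm (a - b))\<^sup>2 \<le> (norm a + norm b)\<^sup>2"
    by (intro power_mono norm_triangle_ineq4) auto
  also have "\<dots> \<le> 2 * (norm a)\<^sup>2 + 2 * (norm b)\<^sup>2"
    using sum_squares_bound[of "norm a" "norm b"] by (simp add: power2_sum)
  finally show ?thesis .
qed

lemma square_integrable_diff:
  fixes F H :: "real \<Rightarrow> 'a::{banach, second_countable_topology}"
  assumes [measurable]: "F \<in> borel_measurable borel" "H \<in> borel_measurable borel"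
    and "integrable lborel (\<lambda>\<xi>. (norm (F \<xi>))\<^sup>2)" "integrable lborel (\<lambda>\<xi>. (norm (H \<xi>))\<^sup>2)"
  shows "integrable lborel (\<lambda>\<xi>. (norm (F \<xi> - H \<xi>))\<^sup>2)"
    and "(LINT \<xi>|lborel. (norm (F \<xi> - H \<xi>))\<^sup>2) \<le>
      2 * (LINT \<xi>|lborel. (norm (F \<xi>))\<^sup>2) + 2 * (LINT \<xi>|lborel. (norm (H \<xi>))\<^sup>2)"
proof -
  have i: "integrable lborel (\<lambda>\<xi>. 2 * (norm (F \<xi>))\<^sup>2 + 2 * (norm (H \<xi>))\<^sup>2)"
    using assms by auto
  show *: "integrable lborel (\<lambda>\<xi>. (norm (F \<xi> - H \<xi>))\<^sup>2)"
    by (rule Bochner_Integration.integrable_bound[OF i]) (auto simp: norm_diff_square_le)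
  have "(LINT \<xi>|lborel. (norm (F \<xi> - H \<xi>))\<^sup>2) \<le> (LINT \<xi>|lborel. 2 * (norm (F \<xi>))\<^sup>2 + 2 * (norm (H \<xi>))\<^sup>2)"
    by (intro integral_mono i * norm_diff_square_le)
  then show "(LINT \<xi>|lborel. (norm (F \<xi> - H \<xi>))\<^sup>2) \<le>
      2 * (LINT \<xi>|lborel. (norm (F \<xi>))\<^sup>2) + 2 * (LINT \<xi>|lborel. (norm (H \<xi>))\<^sup>2)"
    using assms by simp
qed

lemma is_L2_fourier_trunc_error:
  assumes f: "sq_integrable f" and F: "is_L2_fourier f F"
  shows "(\<lambda>\<xi>. F \<xi> - fourier_trunc f R \<xi>) \<in> borel_measurable borel"
    and "integrable lborel (\<lambda>\<xi>. (cmod (F \<xi> - fourier_trunc f R \<xi>))\<^sup>2)"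
proof -
  have [measurable]: "F \<in> borel_measurable borel" "fourier_trunc f R \<in> borel_measurable borel"
    using fourier_trunc_measurable[OF f] F by (auto simp: is_L2_fourier_def)
  show "(\<lambda>\<xi>. F \<xi> - fourier_trunc f R \<xi>) \<in> borel_measurable borel" by measurable
  show "integrable lborel (\<lambda>\<xi>. (cmod (F \<xi> - fourier_trunc f R \<xi>))\<^sup>2)"
    using F fourier_trunc_L2[OF f] by (intro square_integrable_diff) (auto simp: is_L2_fourier_def)
qed

lemma sq_integrable_diff:
  assumes "sq_integrable f" "sq_integrable g"
  shows "sq_integrable (\<lambda>x. f x - g x)"
  using assms square_integrable_diff(1)[of f g] unfolding sq_integrable_def by auto

lemma is_L2_fourier_diff:
  assumes f: "sq_integrable f" and g: "sq_integrable g"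
    and F: "is_L2_fourier f F" and H: "is_L2_fourier g H"
  shows "is_L2_fourier (\<lambda>x. f x - g x) (\<lambda>\<xi>. F \<xi> - H \<xi>)"
proof -
  let ?e = "\<lambda>R. LINT \<xi>|lborel. (cmod (F \<xi> - H \<xi> - fourier_trunc (\<lambda>x. f x - g x) R \<xi>))\<^sup>2"
  let ?b = "\<lambda>R. 2 * (LINT \<xi>|lborel. (cmod (F \<xi> - fourier_trunc f R \<xi>))\<^sup>2) +
      2 * (LINT \<xi>|lborel. (cmod (H \<xi> - fourier_trunc g R \<xi>))\<^sup>2)"
  have le: "?e R \<le> ?b R" for R
  proof -
    have "?e R = (LINT \<xi>|lborel. (cmod ((F \<xi> - fourier_trunc f R \<xi>) - (H \<xi> - fourier_trunc g R \<xi>)))\<^sup>2)"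
      by (simp add: fourier_trunc_diff[OF f g] algebra_simps)
    also have "\<dots> \<le> ?b R"
      by (intro square_integrable_diff is_L2_fourier_trunc_error f g F H)
    finally show ?thesis .
  qed
  have "(?b \<longlongrightarrow> 2 * 0 + 2 * 0) at_top"
    using F H unfolding is_L2_fourier_def by (intro tendsto_intros) auto
  then have "(?e \<longlongrightarrow> 0) at_top"
    by (intro tendsto_sandwich[of "\<lambda>_. 0" ?e _ ?b]) (auto simp: le)
  then show ?thesis
    using F H square_integrable_diff(1)[of F H] by (auto simp: is_L2_fourier_def)
qed

text \<open>Both transforms are L2 limits of the same truncations, so the L2 norm of their
  difference is below a quantity tending to 0.\<close>

lemma is_L2_fourier_unique:
  assumes f: "sq_integrable f" and F: "is_L2_fourier f F" and H: "is_L2_fourier f H"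
  shows "AE \<xi> in lborel. F \<xi> = H \<xi>"
proof -
  let ?b = "\<lambda>R. 2 * (LINT \<xi>|lborel. (cmod (F \<xi> - fourier_trunc f R \<xi>))\<^sup>2) +
      2 * (LINT \<xi>|lborel. (cmod (H \<xi> - fourier_trunc f R \<xi>))\<^sup>2)"
  have int: "integrable lborel (\<lambda>\<xi>. (cmod (F \<xi> - H \<xi>))\<^sup>2)"
    using F H by (intro square_integrable_diff) (auto simp: is_L2_fourier_def)
  have "(LINT \<xi>|lborel. (cmod (F \<xi> - H \<xi>))\<^sup>2) \<le> ?b R" for R
    using square_integrable_diff(2)[OF is_L2_fourier_trunc_error(1)[OF f F, of R]
      is_L2_fourier_trunc_error(1)[OF f H, of R] is_L2_fourier_trunc_error(2)[OF f F, of R]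
      is_L2_fourier_trunc_error(2)[OF f H, of R]] by simp
  moreover have "(?b \<longlongrightarrow> 2 * 0 + 2 * 0) at_top"
    using F H unfolding is_L2_fourier_def by (intro tendsto_intros) auto
  ultimately have "(LINT \<xi>|lborel. (cmod (F \<xi> - H \<xi>))\<^sup>2) \<le> 0"
    by (intro tendsto_lowerbound[of ?b _ at_top]) auto
  then have "(LINT \<xi>|lborel. (cmod (F \<xi> - H \<xi>))\<^sup>2) = 0"
    by (intro antisym integral_nonneg_AE) auto
  then have "AE \<xi> in lborel. (cmod (F \<xi> - H \<xi>))\<^sup>2 = 0"
    using integral_nonneg_eq_0_iff_AE[OF int] by auto
  then show ?thesis by auto
qed

text \<open>\<open>in_Hs\<close> asserts a finite weighted integral for some transform, whereas
  \<open>Hs_norm\<close> integrates an arbitrarily chosen one. Almost everywhere uniqueness moves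
  the finiteness to the chosen one, so that the norm is a true integral and not a default 0.\<close>

lemma Hs_norm_witness:
  assumes "in_Hs s f"
  obtains F where "is_L2_fourier f F"
    and "integrable lborel (\<lambda>\<xi>. (1 + \<xi>\<^sup>2) powr s * (cmod (F \<xi>))\<^sup>2)"
    and "(Hs_norm s f)\<^sup>2 = (LINT \<xi>|lborel. (1 + \<xi>\<^sup>2) powr s * (cmod (F \<xi>))\<^sup>2)"
proof -
  define F where "F = (SOME F. is_L2_fourier f F)"
  from assms obtain H where f: "sq_integrable f" and H: "is_L2_fourier f H"
    and Hi: "integrable lborel (\<lambda>\<xi>. (1 + \<xi>\<^sup>2) powr s * (cmod (H \<xi>))\<^sup>2)"
    unfolding in_Hs_def by auto
  have F: "is_L2_fourier f F" unfolding F_def by (rule someI[of _ H]) (rule H)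
  have [measurable]: "F \<in> borel_measurable borel" "H \<in> borel_measurable borel"
    using F H by (auto simp: is_L2_fourier_def)
  have "AE \<xi> in lborel. (1 + \<xi>\<^sup>2) powr s * (cmod (H \<xi>))\<^sup>2 = (1 + \<xi>\<^sup>2) powr s * (cmod (F \<xi>))\<^sup>2"
    using is_L2_fourier_unique[OF f H F] by auto
  from integrable_cong_AE_imp[OF Hi _ this]
  have "integrable lborel (\<lambda>\<xi>. (1 + \<xi>\<^sup>2) powr s * (cmod (F \<xi>))\<^sup>2)" by simp
  moreover have "(Hs_norm s f)\<^sup>2 = (LINT \<xi>|lborel. (1 + \<xi>\<^sup>2) powr s * (cmod (F \<xi>))\<^sup>2)"
    unfolding Hs_norm_def F_def[symmetric] by (intro real_sqrt_pow2 integral_nonneg_AE) auto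
  ultimately show ?thesis using F that by blast
qed

text \<open>Continuity in time is expressed through the norm of u(t) - u(t0); the embedding can be
  applied to this difference only once it is known to lie in the space.\<close>

lemma in_Hs_diff:
  assumes "in_Hs s f" "in_Hs s g"
  shows "in_Hs s (\<lambda>x. f x - g x)"
proof -
  from assms(1) obtain F where f: "sq_integrable f" and F: "is_L2_fourier f F"
    and Fi: "integrable lborel (\<lambda>\<xi>. (1 + \<xi>\<^sup>2) powr s * (cmod (F \<xi>))\<^sup>2)"
    unfolding in_Hs_def by auto
  from assms(2) obtain H where g: "sq_integrable g" and H: "is_L2_fourier g H"
    and Hi: "integrable lborel (\<lambda>\<xi>. (1 + \<xi>\<^sup>2) powr s * (cmod (H \<xi>))\<^sup>2)"
    unfolding in_Hs_def by auto
  have [measurable]: "F \<in> borel_measurable borel" "H \<in> borel_measurable borel"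
    using F H by (auto simp: is_L2_fourier_def)
  have "integrable lborel (\<lambda>\<xi>. (1 + \<xi>\<^sup>2) powr s * (cmod (F \<xi> - H \<xi>))\<^sup>2)"
  proof (rule Bochner_Integration.integrable_bound)
    show "integrable lborel (\<lambda>\<xi>. 2 * ((1 + \<xi>\<^sup>2) powr s * (cmod (F \<xi>))\<^sup>2) +
        2 * ((1 + \<xi>\<^sup>2) powr s * (cmod (H \<xi>))\<^sup>2))"
      using Fi Hi by auto
    have "(1 + \<xi>\<^sup>2) powr s * (cmod (F \<xi> - H \<xi>))\<^sup>2 \<le>
        2 * ((1 + \<xi>\<^sup>2) powr s * (cmod (F \<xi>))\<^sup>2) + 2 * ((1 + \<xi>\<^sup>2) powr s * (cmod (H \<xi>))\<^sup>2)" for \<xi>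
      using mult_left_mono[OF norm_diff_square_le[of "F \<xi>" "H \<xi>"], of "(1 + \<xi>\<^sup>2) powr s"]
      by (simp add: algebra_simps)
    then show "AE \<xi> in lborel. norm ((1 + \<xi>\<^sup>2) powr s * (cmod (F \<xi> - H \<xi>))\<^sup>2) \<le>
        norm (2 * ((1 + \<xi>\<^sup>2) powr s * (cmod (F \<xi>))\<^sup>2) + 2 * ((1 + \<xi>\<^sup>2) powr s * (cmod (H \<xi>))\<^sup>2))"
      by auto
  qed measurable
  then show ?thesis
    using is_L2_fourier_diff[OF f g F H] sq_integrable_diff[OF f g] unfolding in_Hs_def by blast
qed

section \<open>Sobolev embedding\<close>

text \<open>Comparison with (1 + |x|)^(-2p), which has an explicit primitive. It will be used with p
  = s - 1, and p > 1/2 is exactly the threshold s > 3/2.\<close>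

lemma integrable_inverse_powr_one_plus_square:
  fixes p :: real
  assumes p: "p > 1/2"
  shows "integrable lborel (\<lambda>\<xi>::real. (1 + \<xi>\<^sup>2) powr (-p))"
proof -
  define g where "g x = (1 + x) powr (-2*p)" for x :: real
  define A where "A x = (1 + x) powr (1 - 2*p) / (1 - 2*p)" for x :: real
  have [measurable]: "g \<in> borel_measurable borel" unfolding g_def by measurable
  have "(\<integral>\<^sup>+x. ennreal (g x) * indicator {0..} x \<partial>lborel) = ennreal (0 - A 0)"
  proof (rule nn_integral_FTC_atLeast)
    fix x :: real assume x: "0 \<le> x"
    show "DERIV A x :> g x"
    proof -
      have "((\<lambda>x. (1 + x) powr (1 - 2*p)) has_real_derivative
          ((1 - 2*p) * (1 + x) powr (1 - 2*p - 1)) * 1) (at x)"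
        using x by (intro DERIV_chain2[where g="\<lambda>x. 1 + x"] has_real_derivative_powr) (auto intro!: derivative_eq_intros)
      from DERIV_cdivide[OF this, of "1 - 2*p"] show ?thesis
        using p unfolding A_def g_def by simp
    qed
    show "0 \<le> g x" by (simp add: g_def)
  next
    have "((\<lambda>x. (1 + x) powr (1 - 2*p)) \<longlongrightarrow> 0) at_top"
      using p by (intro tendsto_neg_powr filterlim_tendsto_add_at_top[OF tendsto_const] filterlim_ident) auto
    then show "(A \<longlongrightarrow> 0) at_top" unfolding A_def by (rule tendsto_divide_zero)
  qed measurable
  then have i1: "integrable lborel (\<lambda>x. g x * indicator {0..} x)"
    by (intro integrableI_nonneg) (auto simp: g_def ennreal_mult'' ennreal_indicator)
  have i2: "integrable lborel (\<lambda>x. g (-x) * indicator {0..} (-x))"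
    using lborel_integrable_real_affine[OF i1, of "-1" 0] by simp
  show ?thesis
  proof (rule Bochner_Integration.integrable_bound)
    show "integrable lborel (\<lambda>x. 2 powr p * (g x * indicator {0..} x + g (-x) * indicator {0..} (-x)))"
      using i1 i2 by auto
    have "(1 + x\<^sup>2) powr (-p) \<le> 2 powr p * (g x * indicator {0..} x + g (-x) * indicator {0..} (-x))" for x :: real
    proof -
      have "(1 + \<bar>x\<bar>)\<^sup>2 / 2 \<le> 1 + x\<^sup>2"
        using sum_squares_bound[of 1 "\<bar>x\<bar>"] by (simp add: power2_sum)
      then have "(1 + x\<^sup>2) powr (-p) \<le> ((1 + \<bar>x\<bar>)\<^sup>2 / 2) powr (-p)"
        using p by (intro powr_mono2') auto
      also have "\<dots> = 2 powr p * g \<bar>x\<bar>"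
      proof -
        have "(1 + \<bar>x\<bar>)\<^sup>2 = (1 + \<bar>x\<bar>) powr 2" by simp
        then show ?thesis
          by (simp add: g_def powr_divide powr_powr powr_minus_divide mult.commute del: powr_numeral)
      qed
      also have "g \<bar>x\<bar> \<le> g x * indicator {0..} x + g (-x) * indicator {0..} (-x)"
        by (auto simp: indicator_def g_def)
      finally show ?thesis by (simp add: mult_left_mono)
    qed
    then show "AE x in lborel. norm ((1 + x\<^sup>2) powr (-p)) \<le>
        norm (2 powr p * (g x * indicator {0..} x + g (-x) * indicator {0..} (-x)))"
      by (auto intro!: AE_I2 order_trans[OF _ abs_ge_self])
  qed measurable
qed

section \<open>Gaussian mollification and pointwise Fourier inversion\<close>

lemma integrable_mult_normal_density:
  assumes f: "sq_integrable f" and \<sigma>: "\<sigma> > 0"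
  shows "integrable lborel (\<lambda>y. f y * normal_density x \<sigma> y)"
proof (rule Bochner_Integration.integrable_bound)
  define c where "c = 1 / sqrt (2 * pi * \<sigma>\<^sup>2)"
  have [measurable]: "f \<in> borel_measurable borel" using f by (rule sq_integrable_measurable)
  show "integrable lborel (\<lambda>y. normal_density x \<sigma> y + c * (f y)\<^sup>2)"
    using f \<sigma> by (auto simp: sq_integrable_def)
  have "\<bar>f y\<bar> * normal_density x \<sigma> y \<le> normal_density x \<sigma> y + c * (f y)\<^sup>2" for y
  proof -
    have k: "normal_density x \<sigma> y \<le> c"
      using \<sigma> by (simp add: normal_density_def c_def divide_right_mono)
    have "\<bar>f y\<bar> * normal_density x \<sigma> y \<le> (1 + (f y)\<^sup>2) * normal_density x \<sigma> y"
      by (intro mult_right_mono abs_le_one_plus_square) simp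
    also have "\<dots> \<le> normal_density x \<sigma> y + c * (f y)\<^sup>2"
      using mult_left_mono[OF k, of "(f y)\<^sup>2"] by (simp add: algebra_simps)
    finally show ?thesis .
  qed
  then show "AE y in lborel. norm (f y * normal_density x \<sigma> y) \<le> norm (normal_density x \<sigma> y + c * (f y)\<^sup>2)"
    by (auto simp: abs_mult intro!: AE_I2 order_trans[OF _ abs_ge_self])
  show "(\<lambda>y. f y * normal_density x \<sigma> y) \<in> borel_measurable lborel" by measurable
qed

text \<open>A weighted arithmetic-geometric mean inequality replaces Cauchy--Schwarz: |d| \<le>
  \<eta> + |d|^2/\<eta>. The free parameter \<eta> is fixed before the L2 error of \<open>d\<close>
  is sent to 0.\<close>

lemma gaussian_pairing_error:
  fixes d :: "real \<Rightarrow> complex"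
  assumes \<sigma>: "\<sigma> > 0" and \<eta>: "\<eta> > 0" and [measurable]: "d \<in> borel_measurable borel"
    and d2: "integrable lborel (\<lambda>\<xi>. (cmod (d \<xi>))\<^sup>2)"
  shows "integrable lborel (\<lambda>\<xi>. complex_of_real (exp (- (\<sigma> * \<xi>)\<^sup>2 / 2)) * cis (\<xi> * x) * d \<xi>)"
    and "cmod (LINT \<xi>|lborel. complex_of_real (exp (- (\<sigma> * \<xi>)\<^sup>2 / 2)) * cis (\<xi> * x) * d \<xi>) \<le>
      \<eta> * (LINT \<xi>|lborel. exp (- (\<sigma> * \<xi>)\<^sup>2 / 2)) + (LINT \<xi>|lborel. (cmod (d \<xi>))\<^sup>2) / \<eta>"
proof -
  let ?g = "\<lambda>\<xi>. exp (- (\<sigma> * \<xi>)\<^sup>2 / 2)"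
  have i: "integrable lborel (\<lambda>\<xi>. \<eta> * ?g \<xi> + (cmod (d \<xi>))\<^sup>2 / \<eta>)"
    using d2 integrable_gaussian[OF \<sigma>] by auto
  have le: "cmod (complex_of_real (?g \<xi>) * cis (\<xi> * x) * d \<xi>) \<le> \<eta> * ?g \<xi> + (cmod (d \<xi>))\<^sup>2 / \<eta>" for \<xi>
  proof -
    have "2 * \<eta> * cmod (d \<xi>) \<le> \<eta>\<^sup>2 + (cmod (d \<xi>))\<^sup>2" by (rule sum_squares_bound)
    then have "cmod (d \<xi>) \<le> (\<eta>\<^sup>2 + (cmod (d \<xi>))\<^sup>2) / (2 * \<eta>)" using \<eta> by (simp add: field_simps)
    also have "\<dots> \<le> \<eta> + (cmod (d \<xi>))\<^sup>2 / \<eta>"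
      using \<eta> by (simp add: field_simps power2_eq_square)
    finally have "?g \<xi> * cmod (d \<xi>) \<le> ?g \<xi> * (\<eta> + (cmod (d \<xi>))\<^sup>2 / \<eta>)"
      by (rule mult_left_mono) simp
    also have "\<dots> \<le> \<eta> * ?g \<xi> + (cmod (d \<xi>))\<^sup>2 / \<eta>"
      using mult_right_mono[of "?g \<xi>" 1 "(cmod (d \<xi>))\<^sup>2 / \<eta>"] \<eta> by (simp add: algebra_simps)
    finally show ?thesis by (simp add: norm_mult)
  qed
  show ii: "integrable lborel (\<lambda>\<xi>. complex_of_real (?g \<xi>) * cis (\<xi> * x) * d \<xi>)"
  proof (rule Bochner_Integration.integrable_bound[OF i])
    show "AE \<xi> in lborel. cmod (complex_of_real (?g \<xi>) * cis (\<xi> * x) * d \<xi>) \<le>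
        norm (\<eta> * ?g \<xi> + (cmod (d \<xi>))\<^sup>2 / \<eta>)"
      unfolding real_norm_def by (intro AE_I2 order_trans[OF le abs_ge_self])
  qed measurable
  have "cmod (LINT \<xi>|lborel. complex_of_real (?g \<xi>) * cis (\<xi> * x) * d \<xi>) \<le>
      (LINT \<xi>|lborel. cmod (complex_of_real (?g \<xi>) * cis (\<xi> * x) * d \<xi>))"
    by (rule integral_norm_bound)
  also have "\<dots> \<le> (LINT \<xi>|lborel. \<eta> * ?g \<xi> + (cmod (d \<xi>))\<^sup>2 / \<eta>)"
    by (intro integral_mono i le integrable_norm ii)
  also have "\<dots> = \<eta> * (LINT \<xi>|lborel. ?g \<xi>) + (LINT \<xi>|lborel. (cmod (d \<xi>))\<^sup>2) / \<eta>"
    using d2 integrable_gaussian[OF \<sigma>] by simp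
  finally show "cmod (LINT \<xi>|lborel. complex_of_real (?g \<xi>) * cis (\<xi> * x) * d \<xi>) \<le>
      \<eta> * (LINT \<xi>|lborel. ?g \<xi>) + (LINT \<xi>|lborel. (cmod (d \<xi>))\<^sup>2) / \<eta>" .
qed

text \<open>The damped inversion formula holds for each truncation of \<open>f\<close>. On the space
  side dominated convergence passes to the limit, on the frequency side the L2 convergence in
  \<open>is_L2_fourier\<close> does.\<close>

lemma mollification_fourier:
  assumes f: "sq_integrable f" and F: "is_L2_fourier f F" and \<sigma>: "\<sigma> > 0"
  shows "complex_of_real (2 * pi * (LINT y|lborel. f y * normal_density x \<sigma> y)) =
    (LINT \<xi>|lborel. complex_of_real (exp (- (\<sigma> * \<xi>)\<^sup>2 / 2)) * cis (\<xi> * x) * F \<xi>)"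
proof -
  let ?g = "\<lambda>\<xi>. complex_of_real (exp (- (\<sigma> * \<xi>)\<^sup>2 / 2))"
  let ?k = "normal_density x \<sigma>"
  define I where "I = (LINT \<xi>|lborel. ?g \<xi> * cis (\<xi> * x) * F \<xi>)"
  define c where "c = (LINT \<xi>|lborel. exp (- (\<sigma> * \<xi>)\<^sup>2 / 2))"
  define J where "J n = complex_of_real (2 * pi * (LINT y|lborel. indicator {-real n..real n} y * f y * ?k y))" for n
  have [measurable]: "f \<in> borel_measurable borel" using f by (rule sq_integrable_measurable)
  have "(\<lambda>n. LINT y|lborel. indicator {-real n..real n} y * f y * ?k y) \<longlonglongrightarrow> (LINT y|lborel. f y * ?k y)"
  proof (rule integral_dominated_convergence)
    show "integrable lborel (\<lambda>y. norm (f y * ?k y))"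
      by (intro integrable_norm integrable_mult_normal_density f \<sigma>)
    show "AE y in lborel. (\<lambda>n. indicator {-real n..real n} y * f y * ?k y) \<longlonglongrightarrow> f y * ?k y"
    proof (rule AE_I2)
      fix y :: real
      obtain N :: nat where "\<bar>y\<bar> \<le> real N" using real_arch_simple by blast
      then have "eventually (\<lambda>n. indicator {-real n..real n} y * f y * ?k y = f y * ?k y) sequentially"
        by (intro eventually_sequentiallyI[of N]) (auto simp: indicator_def)
      then show "(\<lambda>n. indicator {-real n..real n} y * f y * ?k y) \<longlonglongrightarrow> f y * ?k y"
        by (rule tendsto_eventually)
    qed
  qed (auto simp: indicator_def)
  then have J1: "J \<longlonglongrightarrow> complex_of_real (2 * pi * (LINT y|lborel. f y * ?k y))"
    unfolding J_def by (intro tendsto_intros)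
  define a where "a n = (LINT \<xi>|lborel. (cmod (F \<xi> - fourier_trunc f (real n) \<xi>))\<^sup>2)" for n :: nat
  have a: "a \<longlonglongrightarrow> 0"
    unfolding a_def using F
    by (auto simp: is_L2_fourier_def intro!: filterlim_compose[OF _ filterlim_real_sequentially])
  have IJ: "cmod (I - J n) \<le> \<eta> * c + a n / \<eta>" if \<eta>: "\<eta> > 0" for n \<eta>
  proof -
    have Fm[measurable]: "F \<in> borel_measurable borel" and F2: "integrable lborel (\<lambda>\<xi>. (cmod (F \<xi>))\<^sup>2)"
      using F by (auto simp: is_L2_fourier_def)
    have "J n = (LINT \<xi>|lborel. ?g \<xi> * cis (\<xi> * x) * fourier_trunc f (real n) \<xi>)"
      unfolding fourier_trunc_eq J_def
      by (rule gaussian_mult_fourier[symmetric, OF \<sigma> sq_integrable_restrict(1)[OF f]])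
    then have "I - J n = (LINT \<xi>|lborel. ?g \<xi> * cis (\<xi> * x) * (F \<xi> - fourier_trunc f (real n) \<xi>))"
      unfolding I_def
      by (simp only: right_diff_distrib Bochner_Integration.integral_diff
        gaussian_pairing_error(1)[OF \<sigma> \<eta> Fm F2]
        gaussian_pairing_error(1)[OF \<sigma> \<eta> fourier_trunc_measurable[OF f] fourier_trunc_L2[OF f]])
    then show ?thesis
      using gaussian_pairing_error(2)[OF \<sigma> \<eta> is_L2_fourier_trunc_error[OF f F]]
      by (simp add: a_def c_def)
  qed
  have c: "c \<ge> 0" unfolding c_def by (rule integral_nonneg_AE) auto
  have "(\<lambda>n. I - J n) \<longlonglongrightarrow> 0"
  proof (rule LIMSEQ_I)
    fix r :: real assume r: "r > 0"
    \<comment> \<open>This makes \<eta> c at most r/2; the 1 avoids a division by 0. With \<eta>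
      fixed, \<open>a n\<close> divided by \<eta> falls below r/2 for large n.\<close>
    define \<eta> where "\<eta> = r / (2 * (c + 1))"
    have \<eta>: "\<eta> > 0" using r c by (simp add: \<eta>_def)
    have "eventually (\<lambda>n. a n < \<eta> * (r / 2)) sequentially"
      using order_tendstoD(2)[OF a, of "\<eta> * (r / 2)"] \<eta> r by simp
    then obtain N where N: "\<And>n. n \<ge> N \<Longrightarrow> a n < \<eta> * (r / 2)"
      by (auto simp: eventually_sequentially)
    show "\<exists>N. \<forall>n\<ge>N. norm (I - J n - 0) < r"
    proof (intro exI[of _ N] allI impI)
      fix n assume "n \<ge> N"
      have "\<eta> * c \<le> r / 2" using r c by (simp add: \<eta>_def field_simps)
      moreover have "a n / \<eta> < r / 2" using N[OF \<open>n \<ge> N\<close>] \<eta> by (simp add: field_simps)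
      ultimately show "norm (I - J n - 0) < r" unfolding diff_zero using IJ[OF \<eta>, of n] by linarith
    qed
  qed
  then have "(\<lambda>n. I - (I - J n)) \<longlonglongrightarrow> I - 0" by (intro tendsto_intros)
  then have "J \<longlonglongrightarrow> I" by simp
  from LIMSEQ_unique[OF J1 this] show ?thesis unfolding I_def .
qed

text \<open>From exp(-w) \<le> 1/w. Away from the centre the density is of order \<sigma> with a
  tail that is integrable and independent of \<sigma>, which controls the far part of a
  mollification.\<close>

lemma normal_density_off_center_le:
  assumes \<sigma>: "\<sigma> > 0" and yx: "y \<noteq> x"
  shows "normal_density x \<sigma> y \<le> 2 * \<sigma> / (y - x)\<^sup>2"
proof -
  define w where "w = (y - x)\<^sup>2 / (2 * \<sigma>\<^sup>2)"
  have w: "w > 0" using \<sigma> yx by (simp add: w_def)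
  have "exp (- w) \<le> 1 / w"
    using exp_ge_add_one_self[of w] w unfolding exp_minus inverse_eq_divide
    by (intro divide_left_mono) (auto simp del: exp_ge_add_one_self)
  moreover have "\<sigma> \<le> sqrt (2 * pi * \<sigma>\<^sup>2)"
  proof -
    have "1 * \<sigma>\<^sup>2 \<le> (2 * pi) * \<sigma>\<^sup>2" using pi_gt3 by (intro mult_right_mono) auto
    then show ?thesis by (intro real_le_rsqrt) simp
  qed
  ultimately have "exp (- w) / sqrt (2 * pi * \<sigma>\<^sup>2) \<le> (1 / w) / \<sigma>"
    using \<sigma> w by (intro frac_le) auto
  moreover have "normal_density x \<sigma> y = exp (- w) / sqrt (2 * pi * \<sigma>\<^sup>2)"
    by (simp add: normal_density_def w_def)
  moreover have "(1 / w) / \<sigma> = 2 * \<sigma> / (y - x)\<^sup>2"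
    using \<sigma> by (simp add: w_def power2_eq_square)
  ultimately show ?thesis by simp
qed

text \<open>Continuity handles |y - x| < \<delta>. Outside, \<open>f\<close> is known only to be
  square integrable; the off-centre bound on the density makes that part at most 2 \<sigma> times
  the integral of the fixed function \<open>D\<close>.\<close>

lemma mollification_tendsto:
  assumes f: "sq_integrable f" and cont: "isCont f x"
  shows "(\<lambda>n. LINT y|lborel. f y * normal_density x (inverse (real (Suc n))) y) \<longlonglongrightarrow> f x"
proof (rule LIMSEQ_I)
  fix e :: real assume e: "e > 0"
  obtain \<delta> where \<delta>: "\<delta> > 0" and near: "\<And>y. \<bar>y - x\<bar> < \<delta> \<Longrightarrow> \<bar>f y - f x\<bar> < e / 2"
    using cont e unfolding continuous_at_eps_delta by (metis dist_real_def half_gt_zero)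
  have [measurable]: "f \<in> borel_measurable borel" using f by (rule sq_integrable_measurable)
  \<comment> \<open>Dominates |f y - f x| / (y - x)^2 for |y - x| \<ge> \<delta>: the f^2 part uses
    the lower bound \<delta>, the constant part is compared with 1/(1 + (y - x)^2). The spelling
    \<open>- x + 1 * y\<close> fits the affine substitution rule.\<close>
  define D where "D y = (f y)\<^sup>2 / \<delta>\<^sup>2 + (1 + \<bar>f x\<bar>) * (1 + 1 / \<delta>\<^sup>2) * (1 + (- x + 1 * y)\<^sup>2) powr (-1)" for y
  have D: "integrable lborel D"
    unfolding D_def[abs_def] using f
    by (intro Bochner_Integration.integrable_add integrable_mult_right lborel_integrable_real_affine
      integrable_inverse_powr_one_plus_square) (auto simp: sq_integrable_def)
  have D_le: "\<bar>f y - f x\<bar> / (y - x)\<^sup>2 \<le> D y" if "\<delta> \<le> \<bar>y - x\<bar>" for y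
  proof -
    define z where "z = (y - x)\<^sup>2"
    have "\<delta>\<^sup>2 \<le> \<bar>y - x\<bar>\<^sup>2" using that \<delta> by (intro power_mono) auto
    then have z: "z \<ge> \<delta>\<^sup>2" "z > 0" using \<delta> by (auto simp: z_def intro: less_le_trans[of 0 "\<delta>\<^sup>2"])
    have "\<bar>f y - f x\<bar> \<le> (f y)\<^sup>2 + (1 + \<bar>f x\<bar>)" using abs_le_one_plus_square[of "f y"] by auto
    from divide_right_mono[OF this, of z]
    have "\<bar>f y - f x\<bar> / z \<le> (f y)\<^sup>2 / z + (1 + \<bar>f x\<bar>) * (1 / z)"
      using z by (simp add: add_divide_distrib)
    also have "\<dots> \<le> (f y)\<^sup>2 / \<delta>\<^sup>2 + (1 + \<bar>f x\<bar>) * ((1 + 1 / \<delta>\<^sup>2) / (1 + z))"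
    proof (intro add_mono mult_left_mono divide_left_mono)
      have "1 / z \<le> 1 / \<delta>\<^sup>2" using z \<delta> by (intro frac_le) auto
      then have "(1 + 1 / z) / (1 + z) \<le> (1 + 1 / \<delta>\<^sup>2) / (1 + z)"
        using z by (intro divide_right_mono) auto
      moreover have "1 + 1 / z = (1 + z) * (1 / z)"
        using z by (simp add: field_simps)
      then have "1 / z = (1 + 1 / z) / (1 + z)"
        using z by simp
      ultimately show "1 / z \<le> (1 + 1 / \<delta>\<^sup>2) / (1 + z)" by simp
    qed (use z \<delta> in auto)
    finally show ?thesis using z(2) by (simp add: D_def z_def powr_minus_divide)
  qed
  have D0: "D y \<ge> 0" for y by (auto simp: D_def)
  have bound: "\<bar>(LINT y|lborel. f y * normal_density x \<sigma> y) - f x\<bar> \<le> e / 2 + 2 * \<sigma> * integral\<^sup>L lborel D"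
    if \<sigma>: "\<sigma> > 0" for \<sigma>
  proof -
    let ?k = "normal_density x \<sigma>"
    have i: "integrable lborel (\<lambda>y. e / 2 * ?k y + 2 * \<sigma> * D y)" using D \<sigma> by auto
    have j: "integrable lborel (\<lambda>y. (f y - f x) * ?k y)"
      unfolding left_diff_distrib using \<sigma> integrable_mult_normal_density[OF f \<sigma>] by auto
    have le: "\<bar>(f y - f x) * ?k y\<bar> \<le> e / 2 * ?k y + 2 * \<sigma> * D y" for y
    proof (cases "\<bar>y - x\<bar> < \<delta>")
      case True
      have "\<bar>f y - f x\<bar> * ?k y \<le> e / 2 * ?k y"
        using near[OF True] by (intro mult_right_mono) auto
      then show ?thesis using \<sigma> D0[of y] by (simp add: abs_mult add_increasing2)
    next
      case False
      have "\<bar>f y - f x\<bar> * ?k y \<le> \<bar>f y - f x\<bar> * (2 * \<sigma> / (y - x)\<^sup>2)"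
        using False \<delta> by (intro mult_left_mono normal_density_off_center_le \<sigma>) auto
      also have "\<dots> = 2 * \<sigma> * (\<bar>f y - f x\<bar> / (y - x)\<^sup>2)" by simp
      also have "\<dots> \<le> 2 * \<sigma> * D y" using False \<sigma> by (intro mult_left_mono D_le) auto
      finally show ?thesis using e by (simp add: abs_mult add_increasing)
    qed
    have "(LINT y|lborel. f y * ?k y) - f x = (LINT y|lborel. (f y - f x) * ?k y)"
      unfolding left_diff_distrib using \<sigma> integrable_mult_normal_density[OF f \<sigma>] by simp
    also have "\<bar>\<dots>\<bar> \<le> (LINT y|lborel. e / 2 * ?k y + 2 * \<sigma> * D y)"
      by (rule order_trans[OF integral_abs_bound integral_mono[OF integrable_abs[OF j] i le]])
    also have "\<dots> = e / 2 + 2 * \<sigma> * integral\<^sup>L lborel D"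
      using D \<sigma> by simp
    finally show ?thesis .
  qed
  have "(\<lambda>n. e / 2 + 2 * inverse (real (Suc n)) * integral\<^sup>L lborel D) \<longlonglongrightarrow> e / 2 + 2 * 0 * integral\<^sup>L lborel D"
    by (intro tendsto_intros LIMSEQ_inverse_real_of_nat)
  then have "eventually (\<lambda>n. e / 2 + 2 * inverse (real (Suc n)) * integral\<^sup>L lborel D < e) sequentially"
    by (rule order_tendstoD(2)) (use e in simp)
  then obtain N where N: "\<And>n. n \<ge> N \<Longrightarrow> e / 2 + 2 * inverse (real (Suc n)) * integral\<^sup>L lborel D < e"
    by (auto simp: eventually_sequentially)
  show "\<exists>N. \<forall>n\<ge>N. norm ((LINT y|lborel. f y * normal_density x (inverse (real (Suc n))) y) - f x) < e"
    using N bound[of "inverse (real (Suc _))"] by (intro exI[of _ N]) (force intro: le_less_trans)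
qed

lemma norm_cis_diff_le: "cmod (cis a - cis b) \<le> \<bar>a - b\<bar>"
proof -
  have "cis a - cis b = cis b * (cis (a - b) - 1)"
    by (simp add: right_diff_distrib cis_mult)
  then have "cmod (cis a - cis b) = cmod (cis (a - b) - 1)"
    by (simp add: norm_mult)
  also have "\<dots> = 2 * \<bar>sin ((a - b) / 2)\<bar>"
    unfolding cis_conv_exp by (rule dist_exp_i_1)
  also have "\<dots> \<le> 2 * \<bar>(a - b) / 2\<bar>" by (intro mult_left_mono abs_sin_x_le_abs_x) auto
  finally show ?thesis by simp
qed

text \<open>Both bounds hold for all Gaussian mollifications with a constant independent of \<sigma>
  and survive \<sigma> \<rightarrow> 0. The factor |\<xi>| in the weight pays for the Lipschitz
  constant of the phase \<open>cis (\<xi> * x)\<close> in x.\<close>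

lemma fourier_L1_bounds:
  assumes f: "sq_integrable f" and F: "is_L2_fourier f F" and cont: "\<And>x. isCont f x"
    and i: "integrable lborel (\<lambda>\<xi>. (1 + \<bar>\<xi>\<bar>) * cmod (F \<xi>))"
  shows "\<bar>f x\<bar> \<le> (LINT \<xi>|lborel. (1 + \<bar>\<xi>\<bar>) * cmod (F \<xi>))"
    and "\<bar>f x - f y\<bar> \<le> (LINT \<xi>|lborel. (1 + \<bar>\<xi>\<bar>) * cmod (F \<xi>)) * \<bar>x - y\<bar>"
proof -
  let ?M = "LINT \<xi>|lborel. (1 + \<bar>\<xi>\<bar>) * cmod (F \<xi>)"
  define m where "m \<sigma> x = (LINT y|lborel. f y * normal_density x \<sigma> y)" for \<sigma> x
  have Fm[measurable]: "F \<in> borel_measurable borel" and F2: "integrable lborel (\<lambda>\<xi>. (cmod (F \<xi>))\<^sup>2)"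
    using F by (auto simp: is_L2_fourier_def)
  \<comment> \<open>The factor 2 pi of the inversion formula is simply dropped, using 1 \<le> 2 pi;
    no sharp constant is needed.\<close>
  have scale: "\<bar>r\<bar> \<le> b" if "2 * pi * \<bar>r\<bar> \<le> b" for r b :: real
  proof -
    have "1 * \<bar>r\<bar> \<le> (2 * pi) * \<bar>r\<bar>" using pi_gt3 by (intro mult_right_mono) auto
    then show ?thesis using that by simp
  qed
  have L1: "cmod (LINT \<xi>|lborel. q \<xi>) \<le> b * ?M"
    if [measurable]: "q \<in> borel_measurable borel" and le: "\<And>\<xi>. cmod (q \<xi>) \<le> b * ((1 + \<bar>\<xi>\<bar>) * cmod (F \<xi>))"
    for q b
  proof -
    have bi: "integrable lborel (\<lambda>\<xi>. b * ((1 + \<bar>\<xi>\<bar>) * cmod (F \<xi>)))" using i by simp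
    have qi: "integrable lborel q"
    proof (rule Bochner_Integration.integrable_bound[OF bi])
      show "AE \<xi> in lborel. cmod (q \<xi>) \<le> norm (b * ((1 + \<bar>\<xi>\<bar>) * cmod (F \<xi>)))"
        unfolding real_norm_def by (intro AE_I2 order_trans[OF le abs_ge_self])
    qed measurable
    have "cmod (LINT \<xi>|lborel. q \<xi>) \<le> (LINT \<xi>|lborel. b * ((1 + \<bar>\<xi>\<bar>) * cmod (F \<xi>)))"
      by (rule order_trans[OF integral_norm_bound integral_mono[OF integrable_norm[OF qi] bi le]])
    then show ?thesis by simp
  qed
  let ?g = "\<lambda>\<sigma> \<xi>. complex_of_real (exp (- (\<sigma> * \<xi>)\<^sup>2 / 2))"
  have g1: "cmod (?g \<sigma> \<xi>) \<le> 1" for \<sigma> \<xi> by simp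
  have m1: "\<bar>m \<sigma> x\<bar> \<le> ?M" if \<sigma>: "\<sigma> > 0" for \<sigma> x
  proof (rule scale)
    have "2 * pi * \<bar>m \<sigma> x\<bar> = cmod (complex_of_real (2 * pi * m \<sigma> x))"
      by (simp only: norm_of_real) (simp add: abs_mult)
    also have "\<dots> = cmod (LINT \<xi>|lborel. ?g \<sigma> \<xi> * cis (\<xi> * x) * F \<xi>)"
      unfolding m_def mollification_fourier[OF f F \<sigma>] ..
    also have "\<dots> \<le> 1 * ?M"
    proof (rule L1)
      fix \<xi>
      have "cmod (?g \<sigma> \<xi> * cis (\<xi> * x) * F \<xi>) \<le> 1 * cmod (F \<xi>)"
        unfolding norm_mult norm_cis mult_1_right by (intro mult_right_mono g1) auto
      also have "\<dots> \<le> (1 + \<bar>\<xi>\<bar>) * cmod (F \<xi>)" by (intro mult_right_mono) auto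
      finally show "cmod (?g \<sigma> \<xi> * cis (\<xi> * x) * F \<xi>) \<le> 1 * ((1 + \<bar>\<xi>\<bar>) * cmod (F \<xi>))" by simp
    qed measurable
    finally show "2 * pi * \<bar>m \<sigma> x\<bar> \<le> ?M" by simp
  qed
  have m2: "\<bar>m \<sigma> x - m \<sigma> y\<bar> \<le> ?M * \<bar>x - y\<bar>" if \<sigma>: "\<sigma> > 0" for \<sigma> x y
  proof (rule scale)
    have "2 * pi * \<bar>m \<sigma> x - m \<sigma> y\<bar> = \<bar>2 * pi * m \<sigma> x - 2 * pi * m \<sigma> y\<bar>"
      by (simp add: abs_mult flip: right_diff_distrib)
    also have "\<dots> = cmod (complex_of_real (2 * pi * m \<sigma> x) - complex_of_real (2 * pi * m \<sigma> y))"
      by (simp only: norm_of_real flip: of_real_diff)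
    also have "\<dots> = cmod (LINT \<xi>|lborel. ?g \<sigma> \<xi> * cis (\<xi> * x) * F \<xi> - ?g \<sigma> \<xi> * cis (\<xi> * y) * F \<xi>)"
      unfolding m_def mollification_fourier[OF f F \<sigma>]
      by (subst Bochner_Integration.integral_diff)
        (simp_all only: gaussian_pairing_error(1)[OF \<sigma> zero_less_one Fm F2])
    also have "\<dots> \<le> \<bar>x - y\<bar> * ?M"
    proof (rule L1)
      fix \<xi>
      have "cmod (?g \<sigma> \<xi> * cis (\<xi> * x) * F \<xi> - ?g \<sigma> \<xi> * cis (\<xi> * y) * F \<xi>) =
          cmod (?g \<sigma> \<xi>) * (cmod (cis (\<xi> * x) - cis (\<xi> * y)) * cmod (F \<xi>))"
        unfolding norm_mult[symmetric] by (simp add: algebra_simps)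
      also have "\<dots> \<le> 1 * (\<bar>\<xi> * x - \<xi> * y\<bar> * cmod (F \<xi>))"
        by (intro mult_mono g1 norm_cis_diff_le) auto
      also have "\<bar>\<xi> * x - \<xi> * y\<bar> = \<bar>\<xi>\<bar> * \<bar>x - y\<bar>"
        by (simp add: abs_mult flip: right_diff_distrib)
      also have "1 * (\<bar>\<xi>\<bar> * \<bar>x - y\<bar> * cmod (F \<xi>)) \<le> \<bar>x - y\<bar> * ((1 + \<bar>\<xi>\<bar>) * cmod (F \<xi>))"
        by (simp add: algebra_simps)
      finally show "cmod (?g \<sigma> \<xi> * cis (\<xi> * x) * F \<xi> - ?g \<sigma> \<xi> * cis (\<xi> * y) * F \<xi>) \<le>
        \<bar>x - y\<bar> * ((1 + \<bar>\<xi>\<bar>) * cmod (F \<xi>))" .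
    qed measurable
    finally show "2 * pi * \<bar>m \<sigma> x - m \<sigma> y\<bar> \<le> ?M * \<bar>x - y\<bar>" by (simp add: mult.commute)
  qed
  let ?\<sigma> = "\<lambda>n. inverse (real (Suc n))"
  have lim: "(\<lambda>n. m (?\<sigma> n) x) \<longlonglongrightarrow> f x" for x
    unfolding m_def by (rule mollification_tendsto[OF f cont])
  show "\<bar>f x\<bar> \<le> ?M"
    by (rule LIMSEQ_le_const2[OF tendsto_rabs[OF lim]]) (use m1 in auto)
  show "\<bar>f x - f y\<bar> \<le> ?M * \<bar>x - y\<bar>"
    by (rule LIMSEQ_le_const2[OF tendsto_rabs[OF tendsto_diff[OF lim lim]]]) (use m2 in auto)
qed

text \<open>The bound is stated in the additive form \<open>C + N\<^sup>2\<close>, which avoids the Cauchy--Schwarz inequality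
  and is enough for boundedness.\<close>

lemma sobolev_embedding:
  assumes s: "s > 3/2"
  obtains C where "C \<ge> 0"
    and "\<And>f x y. in_Hs s f \<Longrightarrow> (\<And>x. isCont f x) \<Longrightarrow> \<bar>f x\<bar> \<le> C + (Hs_norm s f)\<^sup>2"
    and "\<And>f x y. in_Hs s f \<Longrightarrow> (\<And>x. isCont f x) \<Longrightarrow> \<bar>f x - f y\<bar> \<le> (C + (Hs_norm s f)\<^sup>2) * \<bar>x - y\<bar>"
proof -
  define C where "C = 2 * (LINT \<xi>|lborel. (1 + (\<xi>::real)\<^sup>2) powr (-(s - 1)))"
  have w: "integrable lborel (\<lambda>\<xi>::real. (1 + \<xi>\<^sup>2) powr (-(s - 1)))"
    using s by (intro integrable_inverse_powr_one_plus_square) auto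
  have L1: "\<exists>F. is_L2_fourier f F \<and> integrable lborel (\<lambda>\<xi>. (1 + \<bar>\<xi>\<bar>) * cmod (F \<xi>)) \<and>
      (LINT \<xi>|lborel. (1 + \<bar>\<xi>\<bar>) * cmod (F \<xi>)) \<le> C + (Hs_norm s f)\<^sup>2" if f: "in_Hs s f" for f
  proof -
    obtain F where F: "is_L2_fourier f F"
      and Fi: "integrable lborel (\<lambda>\<xi>. (1 + \<xi>\<^sup>2) powr s * (cmod (F \<xi>))\<^sup>2)"
      and N: "(Hs_norm s f)\<^sup>2 = (LINT \<xi>|lborel. (1 + \<xi>\<^sup>2) powr s * (cmod (F \<xi>))\<^sup>2)"
      using Hs_norm_witness[OF f] .
    have [measurable]: "F \<in> borel_measurable borel" using F by (auto simp: is_L2_fourier_def)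
    let ?b = "\<lambda>\<xi>. 2 * (1 + \<xi>\<^sup>2) powr (-(s - 1)) + (1 + \<xi>\<^sup>2) powr s * (cmod (F \<xi>))\<^sup>2"
    have b: "integrable lborel ?b" using w Fi by auto
    have le: "(1 + \<bar>\<xi>\<bar>) * cmod (F \<xi>) \<le> ?b \<xi>" for \<xi>
    proof -
      \<comment> \<open>The elementary inequality 2pq \<le> p^2 + q^2 is applied with p = 1 +
        |\<xi>| and q = A |F|, then divided by \<open>A\<close>; p^2 / A is at most twice the
        integrable weight of exponent 1 - s.\<close>
      define A where "A = (1 + \<xi>\<^sup>2) powr s"
      have A: "A > 0" unfolding A_def by (simp add: add_pos_nonneg less_imp_neq[symmetric])
      have "2 * (1 + \<bar>\<xi>\<bar>) * (A * cmod (F \<xi>)) \<le> (1 + \<bar>\<xi>\<bar>)\<^sup>2 + (A * cmod (F \<xi>))\<^sup>2"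
        by (rule sum_squares_bound)
      moreover have "0 \<le> (1 + \<bar>\<xi>\<bar>) * (A * cmod (F \<xi>))" using A by auto
      ultimately have "A * ((1 + \<bar>\<xi>\<bar>) * cmod (F \<xi>)) \<le> (1 + \<bar>\<xi>\<bar>)\<^sup>2 + A * (A * (cmod (F \<xi>))\<^sup>2)"
        by (simp add: power2_eq_square algebra_simps)
      also have "(1 + \<bar>\<xi>\<bar>)\<^sup>2 \<le> 2 * (1 + \<xi>\<^sup>2)"
        using sum_squares_bound[of 1 "\<bar>\<xi>\<bar>"] by (simp add: power2_sum)
      also have "1 + \<xi>\<^sup>2 = A * (1 + \<xi>\<^sup>2) powr (-(s - 1))"
        unfolding A_def powr_add[symmetric] by (simp add: add_nonneg_nonneg)
      finally have "A * ((1 + \<bar>\<xi>\<bar>) * cmod (F \<xi>)) \<le> A * ?b \<xi>"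
        by (simp add: A_def algebra_simps)
      then show ?thesis using A by simp
    qed
    have i: "integrable lborel (\<lambda>\<xi>. (1 + \<bar>\<xi>\<bar>) * cmod (F \<xi>))"
    proof (rule Bochner_Integration.integrable_bound[OF b])
      show "AE \<xi> in lborel. norm ((1 + \<bar>\<xi>\<bar>) * cmod (F \<xi>)) \<le> norm (?b \<xi>)"
        using le by (auto intro!: AE_I2 order_trans[OF le abs_ge_self] simp: abs_mult)
    qed measurable
    have "(LINT \<xi>|lborel. (1 + \<bar>\<xi>\<bar>) * cmod (F \<xi>)) \<le> integral\<^sup>L lborel ?b"
      by (intro integral_mono i b le)
    also have "\<dots> = C + (Hs_norm s f)\<^sup>2" using w Fi by (simp add: N C_def)
    finally show ?thesis using F i by blast
  qed
  show thesis
  proof (rule that[of C])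
    show "C \<ge> 0" unfolding C_def by (intro mult_nonneg_nonneg integral_nonneg_AE) auto
  next
    fix f :: "real \<Rightarrow> real" and x y :: real
    assume f: "in_Hs s f" and c: "\<And>x. isCont f x"
    from L1[OF f] obtain F where F: "is_L2_fourier f F"
      and i: "integrable lborel (\<lambda>\<xi>. (1 + \<bar>\<xi>\<bar>) * cmod (F \<xi>))"
      and le: "(LINT \<xi>|lborel. (1 + \<bar>\<xi>\<bar>) * cmod (F \<xi>)) \<le> C + (Hs_norm s f)\<^sup>2" by blast
    have sq: "sq_integrable f" using f by (simp add: in_Hs_def)
    show "\<bar>f x\<bar> \<le> C + (Hs_norm s f)\<^sup>2"
      using fourier_L1_bounds(1)[OF sq F c i] le by (rule order_trans)
    show "\<bar>f x - f y\<bar> \<le> (C + (Hs_norm s f)\<^sup>2) * \<bar>x - y\<bar>"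
      using fourier_L1_bounds(2)[OF sq F c i] mult_right_mono[OF le abs_ge_zero] by (rule order_trans)
  qed
qed

text \<open>A finite subcover of [0,T] is taken: near each time r the solution is u(r) plus a
  difference of norm below 1, and the embedding is applied to the two summands separately. This
  bypasses the triangle inequality for \<open>Hs_norm\<close>.\<close>

lemma in_C_Hs_uniform_bounds:
  assumes s: "s > 3/2" and u: "in_C_Hs s T u"
    and cont: "\<And>t x. t \<in> {0..T} \<Longrightarrow> isCont (u t) x"
  obtains B where "B \<ge> 0" and "\<And>t x. t \<in> {0..T} \<Longrightarrow> \<bar>u t x\<bar> \<le> B"
    and "\<And>t x y. t \<in> {0..T} \<Longrightarrow> \<bar>u t x - u t y\<bar> \<le> B * \<bar>x - y\<bar>"
proof -
  obtain C where C: "C \<ge> 0"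
    and C1: "\<And>f x y. in_Hs s f \<Longrightarrow> (\<And>x. isCont f x) \<Longrightarrow> \<bar>f x\<bar> \<le> C + (Hs_norm s f)\<^sup>2"
    and C2: "\<And>f x y. in_Hs s f \<Longrightarrow> (\<And>x. isCont f x) \<Longrightarrow> \<bar>f x - f y\<bar> \<le> (C + (Hs_norm s f)\<^sup>2) * \<bar>x - y\<bar>"
    using sobolev_embedding[OF s] by blast
  have uH: "in_Hs s (u t)" if "t \<in> {0..T}" for t using u that by (auto simp: in_C_Hs_def)
  \<comment> \<open>\<open>C + 1\<close> bounds the difference u(t) - u(r), whose norm is below 1,
    and the other summand bounds u(r).\<close>
  define b where "b r = (C + 1) + (C + (Hs_norm s (u r))\<^sup>2)" for r
  have b0: "b r \<ge> 0" for r using C by (simp add: b_def)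
  have "\<exists>d>0. \<forall>t\<in>{0..T}. \<bar>t - r\<bar> < d \<longrightarrow> (\<forall>x y. \<bar>u t x\<bar> \<le> b r \<and> \<bar>u t x - u t y\<bar> \<le> b r * \<bar>x - y\<bar>)"
    if r: "r \<in> {0..T}" for r
  proof -
    have "((\<lambda>t. Hs_norm s (\<lambda>x. u t x - u r x)) \<longlongrightarrow> 0) (at r within {0..T})"
      using u r by (auto simp: in_C_Hs_def)
    from tendstoD[OF this zero_less_one] obtain d where d: "d > 0"
      and dd: "\<And>t. t \<in> {0..T} \<Longrightarrow> t \<noteq> r \<Longrightarrow> \<bar>t - r\<bar> < d \<Longrightarrow> \<bar>Hs_norm s (\<lambda>x. u t x - u r x)\<bar> < 1"
      unfolding eventually_at by (auto simp: dist_real_def)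
    have "\<bar>u t x\<bar> \<le> b r \<and> \<bar>u t x - u t y\<bar> \<le> b r * \<bar>x - y\<bar>" if t: "t \<in> {0..T}" "\<bar>t - r\<bar> < d" for t x y
    proof (cases "t = r")
      case True
      have "(C + (Hs_norm s (u r))\<^sup>2) * \<bar>x - y\<bar> \<le> b r * \<bar>x - y\<bar>"
        using C by (intro mult_right_mono) (auto simp: b_def)
      then show ?thesis
        using C C1[OF uH[OF r] cont[OF r], of x] C2[OF uH[OF r] cont[OF r], of x y] True
        by (simp add: b_def)
    next
      case False
      let ?d = "\<lambda>x. u t x - u r x"
      have "(Hs_norm s ?d)\<^sup>2 \<le> 1"
        using dd[OF t(1) False t(2)] by (simp add: abs_square_le_1)
      then have n: "C + (Hs_norm s ?d)\<^sup>2 \<le> C + 1" by simp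
      have H: "in_Hs s ?d" "\<And>x. isCont ?d x"
        using in_Hs_diff[OF uH[OF t(1)] uH[OF r]] cont[OF t(1)] cont[OF r] by auto
      have "\<bar>u t x - u r x\<bar> \<le> C + 1" using C1[OF H, of x] n by (rule order_trans)
      moreover have "\<bar>u r x\<bar> \<le> C + (Hs_norm s (u r))\<^sup>2" by (rule C1[OF uH[OF r] cont[OF r]])
      moreover have "\<bar>(u t x - u r x) - (u t y - u r y)\<bar> \<le> (C + 1) * \<bar>x - y\<bar>"
        using C2[OF H, of x y] mult_right_mono[OF n abs_ge_zero] by (rule order_trans)
      moreover have "\<bar>u r x - u r y\<bar> \<le> (C + (Hs_norm s (u r))\<^sup>2) * \<bar>x - y\<bar>"
        by (rule C2[OF uH[OF r] cont[OF r]])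
      moreover have "b r * \<bar>x - y\<bar> = (C + 1) * \<bar>x - y\<bar> + (C + (Hs_norm s (u r))\<^sup>2) * \<bar>x - y\<bar>"
        unfolding b_def by (rule distrib_right)
      ultimately show ?thesis unfolding b_def by linarith
    qed
    then show ?thesis using d by blast
  qed
  then obtain d where d: "\<And>r. r \<in> {0..T} \<Longrightarrow> d r > 0"
    and db: "\<And>r t x y. r \<in> {0..T} \<Longrightarrow> t \<in> {0..T} \<Longrightarrow> \<bar>t - r\<bar> < d r \<Longrightarrow>
      \<bar>u t x\<bar> \<le> b r \<and> \<bar>u t x - u t y\<bar> \<le> b r * \<bar>x - y\<bar>"
    by metis
  obtain R where R: "R \<subseteq> {0..T}" "finite R" "{0..T} \<subseteq> (\<Union>r\<in>R. ball r (d r))"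
  proof (rule compactE_image[of "{0..T}" "{0..T}" "\<lambda>r. ball r (d r)"])
    show "{0..T} \<subseteq> (\<Union>r\<in>{0..T}. ball r (d r))" using d by force
  qed auto
  define B where "B = (\<Sum>r\<in>R. b r)"
  have bB: "b r \<le> B" if "r \<in> R" for r
    unfolding B_def using that R b0 by (intro member_le_sum) auto
  have near: "\<exists>r\<in>R. r \<in> {0..T} \<and> \<bar>t - r\<bar> < d r" if t: "t \<in> {0..T}" for t
  proof -
    obtain r where "r \<in> R" "t \<in> ball r (d r)" using t R(3) by blast
    then show ?thesis using R(1) by (intro bexI[of _ r]) (auto simp: dist_real_def abs_minus_commute)
  qed
  show thesis
  proof (rule that[of B])
    show "B \<ge> 0" unfolding B_def using b0 by (intro sum_nonneg)
  next
    fix t x y assume t: "t \<in> {0..T}"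
    then obtain r where r: "r \<in> R" "r \<in> {0..T}" "\<bar>t - r\<bar> < d r" using near by blast
    have "b r * \<bar>x - y\<bar> \<le> B * \<bar>x - y\<bar>" by (intro mult_right_mono bB r) auto
    then show "\<bar>u t x\<bar> \<le> B" "\<bar>u t x - u t y\<bar> \<le> B * \<bar>x - y\<bar>"
      using db[OF r(2) t r(3), of x y] bB[OF r(1)] by auto
  qed
qed

section \<open>Weighted convolution estimates\<close>

text \<open>For \<epsilon> > 0 this is a shifted and scaled hyperbolic cosine, 2 sqrt \<epsilon>
  cosh(\<alpha> x - (ln \<epsilon>)/2); \<epsilon> = 0 leaves the one-sided weight of the
  theorem.\<close>

definition cosh_weight :: "real \<Rightarrow> real \<Rightarrow> real \<Rightarrow> real" where
  "cosh_weight \<alpha> \<epsilon> x = exp (\<alpha> * x) + \<epsilon> * exp (- \<alpha> * x)"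

text \<open>The two-sided Laplace transform of \<open>G\<close> at \<alpha>; its finiteness is where
  \<alpha> < 1 enters.\<close>

definition G_const :: "real \<Rightarrow> real" where
  "G_const \<alpha> = 1 / (1 - \<alpha>\<^sup>2)"

lemma cosh_weight_pos: "\<epsilon> \<ge> 0 \<Longrightarrow> cosh_weight \<alpha> \<epsilon> x > 0"
  unfolding cosh_weight_def by (intro add_pos_nonneg) auto

text \<open>The increasing exponential is controlled at the right end, the decreasing one at the
  left end. It moves weights at intermediate points, from the mean value theorem or from the jump of
  \<open>Gx\<close>, to the endpoints.\<close>

lemma cosh_weight_between:
  assumes "0 \<le> \<alpha>" "0 \<le> \<epsilon>" "x \<le> z" "z \<le> y"
  shows "cosh_weight \<alpha> \<epsilon> z \<le> cosh_weight \<alpha> \<epsilon> x + cosh_weight \<alpha> \<epsilon> y"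
proof -
  have "exp (\<alpha> * z) \<le> exp (\<alpha> * y)" using assms by (simp add: mult_left_mono)
  moreover have "\<epsilon> * exp (- \<alpha> * z) \<le> \<epsilon> * exp (- \<alpha> * x)"
    using assms by (intro mult_left_mono) (auto simp: mult_left_mono)
  moreover have "0 \<le> \<epsilon> * exp (- \<alpha> * y)" "0 \<le> exp (\<alpha> * x)" using assms by auto
  ultimately show ?thesis unfolding cosh_weight_def by linarith
qed

lemma cosh_weight_deriv:
  "(cosh_weight \<alpha> \<epsilon> has_real_derivative \<alpha> * (exp (\<alpha> * x) - \<epsilon> * exp (- \<alpha> * x))) (at x)"
  unfolding cosh_weight_def[abs_def]
  by (auto intro!: derivative_eq_intros simp: algebra_simps)

lemma cosh_weight_deriv_le:
  assumes "0 \<le> \<alpha>" "\<alpha> \<le> 1" "0 \<le> \<epsilon>"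
  shows "\<bar>\<alpha> * (exp (\<alpha> * x) - \<epsilon> * exp (- \<alpha> * x))\<bar> \<le> cosh_weight \<alpha> \<epsilon> x"
proof -
  have p: "0 \<le> \<epsilon> * exp (- \<alpha> * x)" "0 \<le> exp (\<alpha> * x)" using assms by auto
  have "\<bar>\<alpha> * (exp (\<alpha> * x) - \<epsilon> * exp (- \<alpha> * x))\<bar> \<le> 1 * \<bar>exp (\<alpha> * x) - \<epsilon> * exp (- \<alpha> * x)\<bar>"
    unfolding abs_mult using assms by (intro mult_right_mono) auto
  also have "\<dots> \<le> \<bar>exp (\<alpha> * x)\<bar> + \<bar>\<epsilon> * exp (- \<alpha> * x)\<bar>"
    unfolding mult_1_left by (rule abs_triangle_ineq4)
  also have "\<dots> = cosh_weight \<alpha> \<epsilon> x" using p unfolding cosh_weight_def by simp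
  finally show ?thesis .
qed

text \<open>At either end one of the two exponentials exceeds \<alpha> |x|. Linear growth is enough
  to confine the maximum of the comparison function to a bounded box.\<close>

lemma cosh_weight_ge_linear:
  assumes "0 \<le> \<alpha>" "0 \<le> \<epsilon>"
  shows "min 1 \<epsilon> * \<alpha> * \<bar>x\<bar> \<le> cosh_weight \<alpha> \<epsilon> x"
proof -
  let ?m = "min 1 \<epsilon>"
  have m: "0 \<le> ?m" "?m \<le> 1" "?m \<le> \<epsilon>" using assms by auto
  have "\<alpha> * \<bar>x\<bar> \<le> exp (\<alpha> * \<bar>x\<bar>)" using exp_ge_add_one_self[of "\<alpha> * \<bar>x\<bar>"] by linarith
  also have "\<dots> \<le> exp (\<alpha> * x) + exp (- \<alpha> * x)" by (cases "x \<ge> 0") auto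
  finally have "?m * (\<alpha> * \<bar>x\<bar>) \<le> ?m * (exp (\<alpha> * x) + exp (- \<alpha> * x))"
    using m by (intro mult_left_mono)
  also have "\<dots> \<le> 1 * exp (\<alpha> * x) + \<epsilon> * exp (- \<alpha> * x)"
    unfolding distrib_left using m by (intro add_mono mult_right_mono) auto
  finally show ?thesis by (simp add: cosh_weight_def mult.assoc)
qed

lemma cosh_weight_ge_const:
  assumes "0 < \<epsilon>"
  shows "min 1 \<epsilon> \<le> cosh_weight \<alpha> \<epsilon> x"
proof (cases "\<alpha> * x \<ge> 0")
  case True
  then have "1 \<le> exp (\<alpha> * x)" by simp
  then show ?thesis unfolding cosh_weight_def using assms by (intro min.coboundedI1 add_increasing2) auto
next
  case False
  then have "1 \<le> exp (- \<alpha> * x)" by simp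
  then have "\<epsilon> * 1 \<le> \<epsilon> * exp (- \<alpha> * x)" using assms by (intro mult_left_mono) auto
  then show ?thesis unfolding cosh_weight_def using assms by (intro min.coboundedI2 add_increasing) auto
qed

lemma cosh_weight_measurable [measurable]: "cosh_weight \<alpha> \<epsilon> \<in> borel_measurable borel"
  unfolding cosh_weight_def[abs_def] by measurable

lemma G_measurable [measurable]: "G \<in> borel_measurable borel"
  unfolding G_def[abs_def] by measurable

lemma Gx_measurable [measurable]: "Gx \<in> borel_measurable borel"
  unfolding Gx_def[abs_def] sgn_real_def by measurable

lemma G_nonneg [simp]: "G x \<ge> 0"
  by (simp add: G_def)

section \<open>Convolution of \<open>G\<close> with exponentials and with the weight\<close>

lemma exp_decay_half_line:
  fixes c :: real
  assumes c: "c > 0"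
  shows "integrable lborel (\<lambda>z. exp (- c * z) * indicator {0..} z)"
    and "(LINT z|lborel. exp (- c * z) * indicator {0..} z) = 1 / c"
proof -
  have "(\<integral>\<^sup>+z. ennreal (exp (- c * z)) * indicator {0..} z \<partial>lborel) = ennreal (0 - (- exp (- c * 0) / c))"
  proof (rule nn_integral_FTC_atLeast)
    show "DERIV (\<lambda>z. - exp (- c * z) / c) z :> exp (- c * z)" for z
      using c by (auto intro!: derivative_eq_intros)
    have "((\<lambda>z. exp (- c * z)) \<longlongrightarrow> 0) at_top"
      using c by (intro filterlim_compose[OF exp_at_bot] filterlim_tendsto_neg_mult_at_bot[OF tendsto_const] filterlim_ident) auto
    from tendsto_divide_zero[OF tendsto_minus[OF this, simplified], of c]
    show "((\<lambda>z. - exp (- c * z) / c) \<longlongrightarrow> 0) at_top" by simp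
  qed auto
  then have nn: "(\<integral>\<^sup>+z. ennreal (exp (- c * z) * indicator {0..} z) \<partial>lborel) = ennreal (1 / c)"
    by (simp add: ennreal_mult'' ennreal_indicator)
  have "has_bochner_integral lborel (\<lambda>z. exp (- c * z) * indicator {0..} z) (1 / c)"
    by (rule has_bochner_integral_nn_integral[OF _ _ _ nn]) (use c in auto)
  then show "integrable lborel (\<lambda>z. exp (- c * z) * indicator {0..} z)"
    and "(LINT z|lborel. exp (- c * z) * indicator {0..} z) = 1 / c"
    by (simp_all only: has_bochner_integral_iff)
qed

lemma G_conv_exp:
  fixes \<beta> :: real
  assumes \<beta>: "\<bar>\<beta>\<bar> < 1"
  shows "integrable lborel (\<lambda>y. G (x - y) * exp (\<beta> * y))"
    and "(LINT y|lborel. G (x - y) * exp (\<beta> * y)) \<le> exp (\<beta> * x) / (1 - \<beta>\<^sup>2)"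
proof -
  \<comment> \<open>Equal to G(z) exp(- \<beta> z) except at z = 0, where both indicators contribute
    and \<open>k\<close> is larger; hence an inequality rather than an equality in the comparison
    below.\<close>
  define k where "k z = (exp (- (1 + \<beta>) * z) * indicator {0..} z +
      exp (- (1 - \<beta>) * (- z)) * indicator {0..} (- z)) / 2" for z :: real
  have p: "1 + \<beta> > 0" "1 - \<beta> > 0" using \<beta> by auto
  have r: "integrable lborel (\<lambda>z. exp (- (1 - \<beta>) * (- z)) * indicator {0..} (- z))"
    "(LINT z|lborel. exp (- (1 - \<beta>) * (- z)) * indicator {0..} (- z)) = 1 / (1 - \<beta>)"
    using lborel_integrable_real_affine[OF exp_decay_half_line(1)[OF p(2)], of "-1" 0]
      lborel_integral_real_affine[of "-1" "\<lambda>z. exp (- (1 - \<beta>) * z) * indicator {0..} z" 0]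
      exp_decay_half_line(2)[OF p(2)] by simp_all
  have k: "integrable lborel k"
    unfolding k_def[abs_def] using r exp_decay_half_line(1)[OF p(1)] by auto
  have "(LINT z|lborel. k z) = (1 / (1 + \<beta>) + 1 / (1 - \<beta>)) / 2"
    unfolding k_def using r exp_decay_half_line[OF p(1)] by simp
  also have "\<dots> = 1 / (1 - \<beta>\<^sup>2)"
  proof -
    have "1 - \<beta>\<^sup>2 = (1 + \<beta>) * (1 - \<beta>)" by (simp add: power2_eq_square algebra_simps)
    moreover have "1 / (1 + \<beta>) + 1 / (1 - \<beta>) = 2 / ((1 + \<beta>) * (1 - \<beta>))"
      using p by (simp add: add_frac_eq)
    ultimately show ?thesis by simp
  qed
  finally have k1: "(LINT z|lborel. k z) = 1 / (1 - \<beta>\<^sup>2)" .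
  have bi: "integrable lborel (\<lambda>y. exp (\<beta> * x) * k (x + (-1) * y))"
    by (intro integrable_mult_right lborel_integrable_real_affine k) simp
  have le: "G (x - y) * exp (\<beta> * y) \<le> exp (\<beta> * x) * k (x + (-1) * y)" for y
  proof -
    define z where "z = x - y"
    have "exp (- \<bar>z\<bar>) * exp (- \<beta> * z) / 2 \<le> k z"
      by (cases "z > 0"; cases "z = 0")
        (auto simp: k_def indicator_def algebra_simps simp flip: exp_add)
    then have le: "exp (\<beta> * x) * (exp (- \<bar>z\<bar>) * exp (- \<beta> * z) / 2) \<le> exp (\<beta> * x) * k z"
      by (intro mult_left_mono) auto
    have e: "exp (\<beta> * y) = exp (\<beta> * x) * exp (- \<beta> * z)"
      by (simp add: z_def algebra_simps flip: exp_add)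
    have eq: "G (x - y) * exp (\<beta> * y) = exp (\<beta> * x) * (exp (- \<bar>z\<bar>) * exp (- \<beta> * z) / 2)"
      unfolding e G_def z_def[symmetric] by simp
    have kz: "k (x + (-1) * y) = k z" by (simp add: z_def)
    show ?thesis unfolding eq kz by (rule le)
  qed
  have le': "\<bar>G (x - y) * exp (\<beta> * y)\<bar> \<le> exp (\<beta> * x) * k (x + (-1) * y)" for y
    using le[of y] by (simp add: abs_mult)
  show i: "integrable lborel (\<lambda>y. G (x - y) * exp (\<beta> * y))"
  proof (rule Bochner_Integration.integrable_bound[OF bi])
    show "AE y in lborel. norm (G (x - y) * exp (\<beta> * y)) \<le> norm (exp (\<beta> * x) * k (x + (-1) * y))"
      unfolding real_norm_def by (intro AE_I2 order_trans[OF le' abs_ge_self])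
  qed measurable
  have "(LINT y|lborel. G (x - y) * exp (\<beta> * y)) \<le> (LINT y|lborel. exp (\<beta> * x) * k (x + (-1) * y))"
    by (intro integral_mono i bi le)
  also have "\<dots> = exp (\<beta> * x) / (1 - \<beta>\<^sup>2)"
  proof -
    have k2: "(LINT y|lborel. k (x + (-1) * y)) = 1 / (1 - \<beta>\<^sup>2)"
      using lborel_integral_real_affine[of "-1" k x] k1 by simp
    show ?thesis unfolding integral_mult_right_zero k2 by simp
  qed
  finally show "(LINT y|lborel. G (x - y) * exp (\<beta> * y)) \<le> exp (\<beta> * x) / (1 - \<beta>\<^sup>2)" .
qed

lemma G_conv_cosh_weight:
  assumes "0 < \<alpha>" "\<alpha> < 1" "0 \<le> \<epsilon>"
  shows "integrable lborel (\<lambda>y. G (x - y) * cosh_weight \<alpha> \<epsilon> y)"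
    and "(LINT y|lborel. G (x - y) * cosh_weight \<alpha> \<epsilon> y) \<le> G_const \<alpha> * cosh_weight \<alpha> \<epsilon> x"
proof -
  have e: "G (x - y) * cosh_weight \<alpha> \<epsilon> y = G (x - y) * exp (\<alpha> * y) + \<epsilon> * (G (x - y) * exp (- \<alpha> * y))" for y
    by (simp add: cosh_weight_def algebra_simps)
  have i: "integrable lborel (\<lambda>y. G (x - y) * exp (\<alpha> * y))" "integrable lborel (\<lambda>y. G (x - y) * exp (- \<alpha> * y))"
    using G_conv_exp(1)[of \<alpha> x] G_conv_exp(1)[of "-\<alpha>" x] assms by auto
  show "integrable lborel (\<lambda>y. G (x - y) * cosh_weight \<alpha> \<epsilon> y)"
    unfolding e by (intro Bochner_Integration.integrable_add integrable_mult_right i)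
  have "(LINT y|lborel. G (x - y) * cosh_weight \<alpha> \<epsilon> y) =
      (LINT y|lborel. G (x - y) * exp (\<alpha> * y)) + \<epsilon> * (LINT y|lborel. G (x - y) * exp (- \<alpha> * y))"
    unfolding e using i by simp
  also have "\<dots> \<le> exp (\<alpha> * x) / (1 - \<alpha>\<^sup>2) + \<epsilon> * (exp (- \<alpha> * x) / (1 - \<alpha>\<^sup>2))"
    using G_conv_exp(2)[of \<alpha> x] G_conv_exp(2)[of "-\<alpha>" x] assms by (intro add_mono mult_left_mono) auto
  also have "\<dots> = G_const \<alpha> * cosh_weight \<alpha> \<epsilon> x"
    by (simp add: G_const_def cosh_weight_def add_divide_distrib)
  finally show "(LINT y|lborel. G (x - y) * cosh_weight \<alpha> \<epsilon> y) \<le> G_const \<alpha> * cosh_weight \<alpha> \<epsilon> x" .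
qed

section \<open>Differences of the kernels and of convolutions\<close>

lemma exp_minus_diff_le: "\<bar>exp (- p) - exp (- q)\<bar> \<le> \<bar>p - q\<bar> * (exp (- p) + exp (- q))" for p q :: real
proof -
  have *: "\<bar>exp (- p) - exp (- q)\<bar> \<le> \<bar>p - q\<bar> * (exp (- p) + exp (- q))" if "p \<le> q" for p q :: real
  proof -
    have "exp (- q) \<le> exp (- p)" using that by simp
    have "exp (- q) = exp (- p) * exp (- (q - p))" by (simp flip: exp_add)
    then have "\<bar>exp (- p) - exp (- q)\<bar> = exp (- p) * (1 - exp (- (q - p)))"
      using \<open>exp (- q) \<le> exp (- p)\<close> by (simp add: algebra_simps)
    also have "\<dots> \<le> exp (- p) * (q - p)"
      using exp_ge_add_one_self[of "- (q - p)"] by (intro mult_left_mono) (auto simp del: exp_ge_add_one_self)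
    also have "\<dots> \<le> (exp (- p) + exp (- q)) * (q - p)"
      using that by (intro mult_right_mono) auto
    finally show ?thesis using that by (simp add: mult.commute)
  qed
  show ?thesis
    using *[of p q] *[of q p] by (cases "p \<le> q") (auto simp: abs_minus_commute add.commute)
qed

text \<open>A plain Lipschitz bound for \<open>G\<close> would be useless against a growing weight.
  Keeping \<open>G a + G b\<close> on the right preserves the decay, so the bound can be convolved
  again.\<close>

lemma G_diff_le: "\<bar>G a - G b\<bar> \<le> \<bar>a - b\<bar> * (G a + G b)"
proof -
  have "\<bar>exp (- \<bar>a\<bar>) - exp (- \<bar>b\<bar>)\<bar> \<le> \<bar>\<bar>a\<bar> - \<bar>b\<bar>\<bar> * (exp (- \<bar>a\<bar>) + exp (- \<bar>b\<bar>))"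
    by (rule exp_minus_diff_le)
  also have "\<dots> \<le> \<bar>a - b\<bar> * (exp (- \<bar>a\<bar>) + exp (- \<bar>b\<bar>))"
    by (intro mult_right_mono) auto
  finally show ?thesis by (simp add: G_def diff_divide_distrib[symmetric] add_divide_distrib[symmetric])
qed

lemma Gx_abs_le: "\<bar>Gx a\<bar> \<le> G a"
  by (simp add: Gx_def G_def abs_mult sgn_real_def)

lemma G_le_half: "G a \<le> 1 / 2"
  by (simp add: G_def)

text \<open>\<open>Gx\<close> jumps by 1 at the origin; the indicator charges this jump when
  \<open>a\<close> and \<open>b\<close> do not lie strictly on the same side. On one side
  \<open>Gx\<close> is plus or minus \<open>G\<close>, and the bound for \<open>G\<close>
  applies.\<close>

lemma Gx_diff_le: "\<bar>Gx a - Gx b\<bar> \<le> of_bool (a * b \<le> 0) + \<bar>a - b\<bar> * (G a + G b)"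
proof (cases "a * b \<le> 0")
  case True
  have "\<bar>Gx a - Gx b\<bar> \<le> 1"
    using Gx_abs_le[of a] Gx_abs_le[of b] G_le_half[of a] G_le_half[of b] by linarith
  moreover have "0 \<le> \<bar>a - b\<bar> * (G a + G b)" by (intro mult_nonneg_nonneg add_nonneg_nonneg) auto
  ultimately have "\<bar>Gx a - Gx b\<bar> \<le> 1 + \<bar>a - b\<bar> * (G a + G b)" by linarith
  then show ?thesis using True by simp
next
  case False
  then have "sgn a = sgn b" "\<bar>sgn b\<bar> = 1" by (auto simp: sgn_real_def mult_le_0_iff)
  then have "\<bar>Gx a - Gx b\<bar> = \<bar>G a - G b\<bar>"
    by (auto simp: Gx_def G_def sgn_real_def split: if_splits)
  then show ?thesis using False G_diff_le[of a b] by simp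
qed

lemma kernel_conv_bound:
  assumes \<alpha>: "0 < \<alpha>" "\<alpha> < 1" and \<epsilon>: "0 \<le> \<epsilon>"
    and [measurable]: "k \<in> borel_measurable borel" "F \<in> borel_measurable borel"
    and k: "\<And>z. \<bar>k z\<bar> \<le> G z" and F: "\<And>y. \<bar>F y\<bar> \<le> Q * cosh_weight \<alpha> \<epsilon> y"
  shows "integrable lborel (\<lambda>y. k (x - y) * F y)"
    and "\<bar>conv k F x\<bar> \<le> Q * (G_const \<alpha> * cosh_weight \<alpha> \<epsilon> x)"
proof -
  let ?W = "cosh_weight \<alpha> \<epsilon>"
  have Q: "Q \<ge> 0"
    using F[of 0] cosh_weight_pos[OF \<epsilon>, of \<alpha> 0] by (smt (verit) mult_neg_pos)
  have i: "integrable lborel (\<lambda>y. Q * (G (x - y) * ?W y))"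
    by (intro integrable_mult_right G_conv_cosh_weight \<alpha> \<epsilon>)
  have le: "\<bar>k (x - y) * F y\<bar> \<le> Q * (G (x - y) * ?W y)" for y
    using mult_mono[OF k F, of "x - y" y] by (simp add: abs_mult mult_ac)
  show j: "integrable lborel (\<lambda>y. k (x - y) * F y)"
  proof (rule Bochner_Integration.integrable_bound[OF i])
    show "AE y in lborel. norm (k (x - y) * F y) \<le> norm (Q * (G (x - y) * ?W y))"
      unfolding real_norm_def by (intro AE_I2 order_trans[OF le abs_ge_self])
  qed measurable
  have "\<bar>conv k F x\<bar> \<le> (LINT y|lborel. Q * (G (x - y) * ?W y))"
    unfolding conv_def by (rule order_trans[OF integral_abs_bound integral_mono[OF integrable_abs[OF j] i le]])
  also have "\<dots> \<le> Q * (G_const \<alpha> * ?W x)"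
    using Q G_conv_cosh_weight[OF \<alpha> \<epsilon>] by (auto intro: mult_left_mono)
  finally show "\<bar>conv k F x\<bar> \<le> Q * (G_const \<alpha> * ?W x)" .
qed

text \<open>With a = x - z and b = y - z the jump is charged only for z between x and y, a set of
  measure |x - y|. Thus even the discontinuous kernel \<open>Gx\<close> yields a weighted Lipschitz
  bound, with no regularity of \<open>F\<close> beyond its size.\<close>

lemma kernel_conv_diff_bound:
  assumes \<alpha>: "0 < \<alpha>" "\<alpha> < 1" and \<epsilon>: "0 \<le> \<epsilon>"
    and [measurable]: "k \<in> borel_measurable borel" "F \<in> borel_measurable borel"
    and k: "\<And>z. \<bar>k z\<bar> \<le> G z" and F: "\<And>y. \<bar>F y\<bar> \<le> Q * cosh_weight \<alpha> \<epsilon> y"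
    and kd: "\<And>a b. \<bar>k a - k b\<bar> \<le> of_bool (a * b \<le> 0) + \<bar>a - b\<bar> * (G a + G b)"
  shows "\<bar>conv k F x - conv k F y\<bar> \<le>
    Q * ((1 + G_const \<alpha>) * \<bar>x - y\<bar> * (cosh_weight \<alpha> \<epsilon> x + cosh_weight \<alpha> \<epsilon> y))"
proof -
  let ?W = "cosh_weight \<alpha> \<epsilon>"
  let ?I = "{min x y..max x y}"
  have Q: "Q \<ge> 0"
    using F[of 0] cosh_weight_pos[OF \<epsilon>, of \<alpha> 0] by (smt (verit) mult_neg_pos)
  define h where "h z = (?W x + ?W y) * indicator ?I z + \<bar>x - y\<bar> * (G (x - z) * ?W z + G (y - z) * ?W z)" for z
  have I: "integrable lborel (indicator ?I :: real \<Rightarrow> real)" "(LINT z|lborel. indicator ?I z) = \<bar>x - y\<bar>"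
    by (auto intro!: integrable_real_indicator simp: emeasure_lborel_Icc_eq)
  have hi: "integrable lborel h"
    unfolding h_def[abs_def]
    by (intro Bochner_Integration.integrable_add integrable_mult_right G_conv_cosh_weight I \<alpha> \<epsilon>)
  have hI: "integral\<^sup>L lborel h \<le> (1 + G_const \<alpha>) * \<bar>x - y\<bar> * (?W x + ?W y)"
  proof -
    have "integral\<^sup>L lborel h = (?W x + ?W y) * \<bar>x - y\<bar> +
      \<bar>x - y\<bar> * ((LINT z|lborel. G (x - z) * ?W z) + (LINT z|lborel. G (y - z) * ?W z))"
      unfolding h_def using I G_conv_cosh_weight[OF \<alpha> \<epsilon>] by simp
    also have "\<dots> \<le> (?W x + ?W y) * \<bar>x - y\<bar> + \<bar>x - y\<bar> * (G_const \<alpha> * ?W x + G_const \<alpha> * ?W y)"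
      by (intro add_mono mult_left_mono order_refl G_conv_cosh_weight(2) \<alpha> \<epsilon>) auto
    finally show ?thesis by (simp add: algebra_simps)
  qed
  have ji: "integrable lborel (\<lambda>z. k (x - z) * F z - k (y - z) * F z)"
    by (intro Bochner_Integration.integrable_diff kernel_conv_bound(1)[OF \<alpha> \<epsilon> _ _ k F]) measurable
  have le: "\<bar>k (x - z) * F z - k (y - z) * F z\<bar> \<le> Q * h z" for z
  proof -
    let ?b = "of_bool ((x - z) * (y - z) \<le> 0) :: real"
    \<comment> \<open>The product (x - z)(y - z) is nonpositive exactly when z lies between x and
      y.\<close>
    have b: "?b = indicator ?I z"
      by (auto simp: indicator_def mult_le_0_iff)
    have bW: "?b * ?W z \<le> (?W x + ?W y) * indicator ?I z"
    proof (cases "z \<in> ?I")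
      case True
      then have "?W z \<le> ?W x + ?W y"
        using cosh_weight_between[of \<alpha> \<epsilon> "min x y" z "max x y"] \<alpha> \<epsilon> by (auto simp: min_def max_def split: if_splits)
      then show ?thesis using True by (simp add: b)
    qed (simp add: b)
    have "\<bar>k (x - z) * F z - k (y - z) * F z\<bar> = \<bar>k (x - z) - k (y - z)\<bar> * \<bar>F z\<bar>"
      by (simp add: abs_mult flip: left_diff_distrib)
    also have "\<dots> \<le> (?b + \<bar>(x - z) - (y - z)\<bar> * (G (x - z) + G (y - z))) * (Q * ?W z)"
      by (intro mult_mono kd F add_nonneg_nonneg mult_nonneg_nonneg) auto
    also have "\<dots> = Q * (?b * ?W z + \<bar>x - y\<bar> * (G (x - z) * ?W z + G (y - z) * ?W z))"
      by (simp add: algebra_simps)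
    also have "\<dots> \<le> Q * h z"
      unfolding h_def by (intro mult_left_mono add_right_mono bW Q)
    finally show ?thesis .
  qed
  have "conv k F x - conv k F y = (LINT z|lborel. k (x - z) * F z - k (y - z) * F z)"
    unfolding conv_def
    by (intro Bochner_Integration.integral_diff[symmetric] kernel_conv_bound(1)[OF \<alpha> \<epsilon> _ _ k F]) measurable
  also have "\<bar>\<dots>\<bar> \<le> (LINT z|lborel. Q * h z)"
    by (rule order_trans[OF integral_abs_bound integral_mono[OF integrable_abs[OF ji] integrable_mult_right[OF hi] le]])
  also have "\<dots> \<le> Q * ((1 + G_const \<alpha>) * \<bar>x - y\<bar> * (?W x + ?W y))"
    using hI Q by (auto intro: mult_left_mono)
  finally show ?thesis .
qed

text \<open>Derivatives are not known to be continuous here; as pointwise limits of difference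
  quotients they are still measurable, which is all that the convolutions require.\<close>

lemma deriv_measurable:
  fixes f :: "real \<Rightarrow> real"
  assumes d: "\<And>x. (f has_real_derivative deriv f x) (at x)"
  shows "deriv f \<in> borel_measurable borel"
proof (rule borel_measurable_LIMSEQ_real)
  have c: "continuous_on UNIV f"
    by (intro continuous_at_imp_continuous_on ballI DERIV_isCont[OF d])
  have [measurable]: "f \<in> borel_measurable borel"
    by (rule borel_measurable_continuous_onI[OF c])
  show "(\<lambda>x. (f (x + inverse (real (Suc n))) - f x) / inverse (real (Suc n))) \<in> borel_measurable borel" for n
    by measurable
  fix x
  have "((\<lambda>h. (f (x + h) - f x) / h) \<longlongrightarrow> deriv f x) (at 0)"
    using d[of x] by (simp add: DERIV_def)
  then show "(\<lambda>n. (f (x + inverse (real (Suc n))) - f x) / inverse (real (Suc n))) \<longlonglongrightarrow> deriv f x"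
    by (rule filterlim_compose)
      (auto simp: filterlim_at intro!: LIMSEQ_inverse_real_of_nat[simplified])
qed

section \<open>A maximum principle for difference quotients\<close>

text \<open>One compares at the intermediate point with the new time and the old position: the
  Lipschitz constant is uniform in time, so separate regularity gives the joint continuity needed to
  attain a maximum on a compact box.\<close>

lemma continuous_on_Lipschitz_separately:
  fixes a :: "real \<Rightarrow> real \<Rightarrow> real"
  assumes t: "\<And>x. continuous_on S (\<lambda>t. a t x)"
    and x: "\<And>t x y. t \<in> S \<Longrightarrow> \<bar>a t x - a t y\<bar> \<le> B * \<bar>x - y\<bar>"
  shows "continuous_on (S \<times> UNIV) (\<lambda>p. a (fst p) (snd p))"
  unfolding continuous_on_def
proof
  fix p :: "real \<times> real" assume p: "p \<in> S \<times> UNIV"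
  let ?F = "at p within S \<times> UNIV"
  let ?b = "\<lambda>q. B * \<bar>snd q - snd p\<bar> + \<bar>a (fst q) (snd p) - a (fst p) (snd p)\<bar>"
  have "continuous_on (S \<times> UNIV) (\<lambda>q::real\<times>real. a (fst q) (snd p))"
    by (rule continuous_on_compose2[OF t[of "snd p"] continuous_on_fst[OF continuous_on_id]]) auto
  then have "((\<lambda>q. a (fst q) (snd p)) \<longlongrightarrow> a (fst p) (snd p)) ?F"
    using p by (auto simp: continuous_on_def)
  then have "(?b \<longlongrightarrow> B * \<bar>snd p - snd p\<bar> + \<bar>a (fst p) (snd p) - a (fst p) (snd p)\<bar>) ?F"
    by (intro tendsto_intros)
  then have b: "(?b \<longlongrightarrow> 0) ?F" by simp
  have "((\<lambda>q. a (fst q) (snd q) - a (fst p) (snd p)) \<longlongrightarrow> 0) ?F"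
  proof (rule Lim_null_comparison[OF _ b])
    show "eventually (\<lambda>q. norm (a (fst q) (snd q) - a (fst p) (snd p)) \<le> ?b q) ?F"
      unfolding eventually_at_filter
    proof (intro always_eventually allI impI)
      fix q :: "real \<times> real" assume "q \<in> S \<times> UNIV"
      then have "\<bar>a (fst q) (snd q) - a (fst q) (snd p)\<bar> \<le> B * \<bar>snd q - snd p\<bar>" by (intro x) auto
      then show "norm (a (fst q) (snd q) - a (fst p) (snd p)) \<le> ?b q" by simp
    qed
  qed
  then show "((\<lambda>q. a (fst q) (snd q)) \<longlongrightarrow> a (fst p) (snd p)) ?F"
    by (simp add: LIM_zero_iff)
qed

text \<open>At a positive maximum of the function \<open>H\<close> below its \<open>x\<close>- and \<open>y\<close>-derivatives vanish, which
  turns the transport terms into derivatives of the explicit barrier. This replaces the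
  method of characteristics and needs no second derivatives of \<open>a\<close>. The barrier uses
  \<open>sqrt ((x - y)\<^sup>2 + \<delta>\<^sup>2)\<close> because \<open>\<bar>x - y\<bar>\<close> is not differentiable on the diagonal.\<close>

lemma transport_comparison_regularised:
  fixes a ax U P :: "real \<Rightarrow> real \<Rightarrow> real"
  assumes \<alpha>: "0 < \<alpha>" "\<alpha> \<le> 1" and \<epsilon>: "0 < \<epsilon>" and \<delta>: "0 < \<delta>" and B: "B \<ge> 0" and A: "A \<ge> 0"
    and \<mu>: "\<mu> \<ge> 0" and N: "0 < N" "K \<le> N" "Q < N * (\<mu> - 2 * A)" and K: "K \<ge> 0"
    and bd: "\<And>t x. t \<in> {0..T} \<Longrightarrow> \<bar>a t x\<bar> \<le> B"
    and lip: "\<And>t x y. t \<in> {0..T} \<Longrightarrow> \<bar>a t x - a t y\<bar> \<le> B * \<bar>x - y\<bar>"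
    and dx: "\<And>t x. t \<in> {0..T} \<Longrightarrow> (a t has_real_derivative ax t x) (at x)"
    and dt: "\<And>t x. t \<in> {0..T} \<Longrightarrow>
      ((\<lambda>\<tau>. a \<tau> x) has_real_derivative - (U t x * ax t x + P t x)) (at t within {0..T})"
    and U: "\<And>t x. t \<in> {0..T} \<Longrightarrow> \<bar>U t x\<bar> \<le> A"
    and Ulip: "\<And>t x y. t \<in> {0..T} \<Longrightarrow> \<bar>U t x - U t y\<bar> \<le> A * \<bar>x - y\<bar>"
    and P: "\<And>t x y. t \<in> {0..T} \<Longrightarrow> \<bar>P t x - P t y\<bar> \<le>
      Q * exp (\<mu> * t) * \<bar>x - y\<bar> * (cosh_weight \<alpha> \<epsilon> x + cosh_weight \<alpha> \<epsilon> y)"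
    and init: "\<And>x y. \<bar>a 0 x - a 0 y\<bar> \<le> K * \<bar>x - y\<bar> * (cosh_weight \<alpha> \<epsilon> x + cosh_weight \<alpha> \<epsilon> y)"
    and t1: "t1 \<in> {0..T}"
  shows "a t1 x1 - a t1 y1 \<le>
    N * exp (\<mu> * t1) * (cosh_weight \<alpha> \<epsilon> x1 + cosh_weight \<alpha> \<epsilon> y1) * sqrt ((x1 - y1)\<^sup>2 + \<delta>\<^sup>2)"
proof (rule ccontr)
  define W where "W = cosh_weight \<alpha> \<epsilon>"
  define W' where "W' x = \<alpha> * (exp (\<alpha> * x) - \<epsilon> * exp (- \<alpha> * x))" for x
  define r where "r z = sqrt (z\<^sup>2 + \<delta>\<^sup>2)" for z :: real
  define H where "H t x y = a t x - a t y - N * exp (\<mu> * t) * ((W x + W y) * r (x - y))" for t x y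
  assume "\<not> a t1 x1 - a t1 y1 \<le>
    N * exp (\<mu> * t1) * (cosh_weight \<alpha> \<epsilon> x1 + cosh_weight \<alpha> \<epsilon> y1) * sqrt ((x1 - y1)\<^sup>2 + \<delta>\<^sup>2)"
  then have H1: "H t1 x1 y1 > 0" by (simp add: H_def W_def r_def mult.assoc)
  have W0: "W x > 0" for x unfolding W_def using \<epsilon> by (intro cosh_weight_pos) auto
  have W'_le: "\<bar>W' x\<bar> \<le> W x" for x
    unfolding W_def W'_def using \<alpha> \<epsilon> by (intro cosh_weight_deriv_le) auto
  have dW: "(W has_real_derivative W' x) (at x)" for x
    unfolding W_def W'_def by (rule cosh_weight_deriv)
  have zd: "z\<^sup>2 + \<delta>\<^sup>2 > 0" for z :: real using \<delta> by (intro add_nonneg_pos) auto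
  have r\<delta>: "r z \<ge> \<delta>" for z unfolding r_def using \<delta> by (intro real_le_rsqrt) auto
  have r0: "r z > 0" for z using r\<delta>[of z] \<delta> by linarith
  have rz: "\<bar>z\<bar> \<le> r z" for z unfolding r_def by (intro real_le_rsqrt) auto
  have rr: "r z * r z = z\<^sup>2 + \<delta>\<^sup>2" for z unfolding r_def using zd[of z] by simp
  have dr: "(r has_real_derivative z / r z) (at z)" for z
    unfolding r_def[abs_def] using zd[of z]
    by (auto intro!: derivative_eq_intros simp: field_simps)
  have W_cont: "continuous_on UNIV W"
    by (intro continuous_at_imp_continuous_on ballI DERIV_isCont[OF dW])
  have r_cont: "continuous_on UNIV r" unfolding r_def[abs_def] by (intro continuous_intros)
  have a_cont: "continuous_on ({0..T} \<times> UNIV) (\<lambda>p. a (fst p) (snd p))"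
  proof (rule continuous_on_Lipschitz_separately[OF _ lip])
    show "continuous_on {0..T} (\<lambda>t. a t x)" for x
      using dt[of _ x] by (intro DERIV_continuous_on) auto
  qed
  define m where "m = min 1 \<epsilon> * \<alpha>"
  have m: "m > 0" using \<alpha> \<epsilon> by (simp add: m_def)
  \<comment> \<open>Beyond this radius the barrier is at least 2B, which bounds a(t,x) - a(t,y), so
    \<open>H\<close> is nonpositive there. Adding |x1| + |y1| keeps the assumed positive point
    inside the box.\<close>
  define R where "R = 2 * B / (N * \<delta>) / m + \<bar>x1\<bar> + \<bar>y1\<bar>"
  have R0: "2 * B / (N * \<delta>) / m \<ge> 0" using B N \<delta> m by simp
  have W_big: "2 * B / (N * \<delta>) \<le> W x" if "R \<le> \<bar>x\<bar>" for x
  proof -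
    have "2 * B / (N * \<delta>) / m \<le> \<bar>x\<bar>" using that by (simp add: R_def)
    then have "2 * B / (N * \<delta>) \<le> m * \<bar>x\<bar>" unfolding pos_divide_le_eq[OF m] by (simp only: mult.commute)
    also have "\<dots> \<le> W x" unfolding W_def m_def using \<alpha> \<epsilon> by (intro cosh_weight_ge_linear) auto
    finally show ?thesis .
  qed
  let ?K = "{0..T} \<times> ({-R..R} \<times> {-R..R})"
  have "compact ?K" by (intro compact_Times compact_Icc)
  moreover have "(t1, x1, y1) \<in> ?K" using t1 R0 by (auto simp: R_def)
  moreover have "continuous_on ?K (\<lambda>(t, x, y). H t x y)"
    unfolding H_def case_prod_unfold
    by (intro continuous_intros continuous_on_compose2[OF a_cont, of _ "\<lambda>p. (fst p, fst (snd p))", simplified]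
        continuous_on_compose2[OF a_cont, of _ "\<lambda>p. (fst p, snd (snd p))", simplified]
        continuous_on_compose2[OF W_cont] continuous_on_compose2[OF r_cont]) auto
  ultimately obtain p where p: "p \<in> ?K" "\<And>q. q \<in> ?K \<Longrightarrow> (\<lambda>(t, x, y). H t x y) q \<le> (\<lambda>(t, x, y). H t x y) p"
    using continuous_attains_sup[of ?K "\<lambda>(t, x, y). H t x y"] by blast
  obtain t x y where pe: "p = (t, x, y)" by (cases p) auto
  have t: "t \<in> {0..T}" using p pe by auto
  have Hpos: "H t x y > 0" using p(2)[OF \<open>(t1, x1, y1) \<in> ?K\<close>] H1 by (simp add: pe)
  have max: "H t' x' y' \<le> H t x y" if t': "t' \<in> {0..T}" for t' x' y'
  proof (cases "\<bar>x'\<bar> \<le> R \<and> \<bar>y'\<bar> \<le> R")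
    case True
    then show ?thesis using p(2)[of "(t', x', y')"] t' by (auto simp: pe abs_le_iff)
  next
    case False
    then have "2 * B / (N * \<delta>) \<le> W x' + W y'"
      using W_big[of x'] W_big[of y'] W0[of x'] W0[of y'] by (cases "\<bar>x'\<bar> \<le> R") auto
    then have "2 * B \<le> N * \<delta> * (W x' + W y')"
      using N \<delta> by (simp add: pos_divide_le_eq mult.commute)
    also have "\<dots> = N * 1 * ((W x' + W y') * \<delta>)" by simp
    also have "\<dots> \<le> N * exp (\<mu> * t') * ((W x' + W y') * r (x' - y'))"
      using t' \<mu> N W0[of x'] W0[of y'] r\<delta> \<delta> by (intro mult_mono) auto
    finally have "H t' x' y' \<le> 0"
      using bd[OF t', of x'] bd[OF t', of y'] unfolding H_def by linarith
    then show ?thesis using Hpos by linarith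
  qed
  define E where "E = N * exp (\<mu> * t)"
  have E: "E > 0" using N by (simp add: E_def)
  let ?V = "(W x + W y) * r (x - y)"
  have V: "?V > 0" using W0[of x] W0[of y] r0 by (intro mult_pos_pos add_pos_pos)
  show False
  \<comment> \<open>At time 0 there are no earlier times to compare with; the initial bound and K
    \<le> N settle this case.\<close>
  proof (cases "t = 0")
    case True
    have "a 0 x - a 0 y \<le> K * \<bar>x - y\<bar> * (W x + W y)" using init[of x y] by (simp add: W_def)
    also have "\<dots> \<le> N * r (x - y) * (W x + W y)"
      using N K rz W0[of x] W0[of y] r0[of "x - y"] by (intro mult_mono) (auto intro: less_imp_le)
    finally show False using Hpos True by (simp add: H_def mult_ac)
  next
    case False
    define \<rho> where "\<rho> = (x - y) / r (x - y)"
    have Dx: "((\<lambda>x. H t x y) has_real_derivative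
        ax t x - E * (W' x * r (x - y) + (W x + W y) * \<rho>)) (at x)"
      unfolding H_def E_def[symmetric] \<rho>_def
      by (auto intro!: derivative_eq_intros dx[OF t] dW DERIV_chain2[OF dr])
    have x0: "ax t x = E * (W' x * r (x - y) + (W x + W y) * \<rho>)"
      using DERIV_local_max[OF Dx zero_less_one] max[OF t] by auto
    have Dy: "((\<lambda>y. H t x y) has_real_derivative
        - ax t y - E * (W' y * r (x - y) - (W x + W y) * \<rho>)) (at y)"
      unfolding H_def E_def[symmetric] \<rho>_def
      by (auto intro!: derivative_eq_intros dx[OF t] dW DERIV_chain2[OF dr])
    have y0: "ax t y = - (E * (W' y * r (x - y) - (W x + W y) * \<rho>))"
      using DERIV_local_max[OF Dy zero_less_one] max[OF t] by auto
    let ?L = "- (U t x * ax t x + P t x) + (U t y * ax t y + P t y) - \<mu> * E * ?V"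
    have Dt: "((\<lambda>t. H t x y) has_real_derivative ?L) (at t within {0..T})"
      unfolding H_def E_def
      by (auto intro!: derivative_eq_intros dt[OF t])
    \<comment> \<open>Only earlier times are compared, so a maximum attained at t = T is covered as
      well.\<close>
    have "?L \<ge> 0"
    proof (rule ccontr)
      assume "\<not> ?L \<ge> 0"
      then obtain d where d: "d > 0" "\<And>h. h > 0 \<Longrightarrow> t - h \<in> {0..T} \<Longrightarrow> h < d \<Longrightarrow> H t x y < H (t - h) x y"
        using has_real_derivative_neg_dec_left[OF Dt] by auto
      define h where "h = min (d / 2) t"
      have "h > 0" "h < d" "t - h \<in> {0..T}" using d(1) t False by (auto simp: h_def min_def)
      then show False using d(2)[of h] max[of "t - h" x y] by auto
    qed
    then have "\<mu> * E * ?V \<le> - (U t x * ax t x - U t y * ax t y) - (P t x - P t y)" by linarith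
    \<comment> \<open>The first group contains derivatives of the weight, bounded by the weight
      itself. In the second the slope of the regularised distance has opposite signs at x and y, so
      only the difference of \<open>U\<close> survives, which is Lipschitz.\<close>
    also have "U t x * ax t x - U t y * ax t y =
        E * (r (x - y) * (U t x * W' x + U t y * W' y) + (W x + W y) * (\<rho> * (U t x - U t y)))"
      unfolding x0 y0 by (simp add: algebra_simps)
    finally have main: "\<mu> * E * ?V \<le>
        E * \<bar>r (x - y) * (U t x * W' x + U t y * W' y) + (W x + W y) * (\<rho> * (U t x - U t y))\<bar> + \<bar>P t x - P t y\<bar>"
      using E by (smt (verit) mult_left_mono minus_mult_right)
    have UW: "\<bar>U t z * W' z\<bar> \<le> A * W z" for z
      unfolding abs_mult using U[OF t] W'_le A by (intro mult_mono) auto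
    have "\<bar>r (x - y) * (U t x * W' x + U t y * W' y)\<bar> \<le> r (x - y) * (A * W x + A * W y)"
    proof -
      have "\<bar>U t x * W' x + U t y * W' y\<bar> \<le> A * W x + A * W y" using UW[of x] UW[of y] by linarith
      then have "\<bar>r (x - y)\<bar> * \<bar>U t x * W' x + U t y * W' y\<bar> \<le> \<bar>r (x - y)\<bar> * (A * W x + A * W y)"
        by (rule mult_left_mono) simp
      then show ?thesis unfolding abs_mult abs_of_pos[OF r0] .
    qed
    moreover have "\<bar>(W x + W y) * (\<rho> * (U t x - U t y))\<bar> \<le> (W x + W y) * (A * r (x - y))"
    proof -
      have "\<bar>\<rho>\<bar> \<le> 1" unfolding \<rho>_def using rz[of "x - y"] r0[of "x - y"] by (simp add: abs_of_pos)
      then have "\<bar>\<rho>\<bar> * \<bar>U t x - U t y\<bar> \<le> 1 * (A * r (x - y))"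
        using A rz[of "x - y"] order_trans[OF Ulip[OF t, of x y] mult_left_mono[OF rz A]]
        by (intro mult_mono) auto
      then show ?thesis
        unfolding abs_mult abs_of_pos[OF add_pos_pos[OF W0 W0]] mult_1_left
        using W0[of x] W0[of y] by (intro mult_left_mono) auto
    qed
    ultimately have "\<bar>r (x - y) * (U t x * W' x + U t y * W' y) + (W x + W y) * (\<rho> * (U t x - U t y))\<bar>
        \<le> r (x - y) * (A * W x + A * W y) + (W x + W y) * (A * r (x - y))"
      by linarith
    \<comment> \<open>One \<open>A\<close> comes from the size of \<open>U\<close> with |W'| \<le>
      W, the other from its Lipschitz constant with |x - y| \<le> r(x - y). This is the loss 2A in
      the condition on \<mu>.\<close>
    also have "\<dots> = 2 * A * ?V" by (simp add: algebra_simps)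
    finally have "E * \<bar>r (x - y) * (U t x * W' x + U t y * W' y) + (W x + W y) * (\<rho> * (U t x - U t y))\<bar> \<le> E * (2 * A * ?V)"
      using E by (intro mult_left_mono) auto
    moreover have "\<bar>P t x - P t y\<bar> \<le> Q * exp (\<mu> * t) * ?V"
    proof -
      have Q: "Q \<ge> 0"
      proof -
        have "0 \<le> Q * exp (\<mu> * t) * \<bar>0 - 1\<bar> * (W 0 + W 1)"
          using P[OF t, of 0 1] abs_ge_zero[of "P t 0 - P t 1"] unfolding W_def by linarith
        then show ?thesis using W0[of 0] W0[of 1] by (auto simp: zero_le_mult_iff)
      qed
      have "\<bar>P t x - P t y\<bar> \<le> Q * exp (\<mu> * t) * \<bar>x - y\<bar> * (W x + W y)" using P[OF t] by (simp add: W_def)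
      also have "\<dots> \<le> Q * exp (\<mu> * t) * r (x - y) * (W x + W y)"
        using Q rz W0[of x] W0[of y] by (intro mult_right_mono mult_left_mono) auto
      finally show ?thesis by (simp add: mult_ac)
    qed
    ultimately have "\<mu> * E * ?V \<le> E * (2 * A * ?V) + Q * exp (\<mu> * t) * ?V" using main by linarith
    then have "(N * (\<mu> - 2 * A) - Q) * (exp (\<mu> * t) * ?V) \<le> 0"
      by (simp add: E_def algebra_simps)
    moreover have "(N * (\<mu> - 2 * A) - Q) * (exp (\<mu> * t) * ?V) > 0"
      by (rule mult_pos_pos[OF _ mult_pos_pos[OF exp_gt_zero V]]) (use N in simp)
    ultimately show False by linarith
  qed
qed

lemma sqrt_sum_squares_regularisation_limit:
  fixes X M z :: real
  assumes M: "M \<ge> 0" and le: "\<And>\<delta>. \<delta> > 0 \<Longrightarrow> X \<le> M * sqrt (z\<^sup>2 + \<delta>\<^sup>2)"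
  shows "X \<le> M * \<bar>z\<bar>"
proof -
  have "((\<lambda>\<delta>::real. M * sqrt (z\<^sup>2 + \<delta>\<^sup>2)) \<longlongrightarrow> M * sqrt (z\<^sup>2 + 0\<^sup>2)) (at_right 0)"
    by (intro tendsto_intros)
  then have "X \<le> M * sqrt (z\<^sup>2 + 0\<^sup>2)"
    by (rule tendsto_lowerbound) (auto simp: eventually_at_right_less eventually_at_filter le)
  then show ?thesis by simp
qed

text \<open>After division by |y - x| both weights tend to \<open>W x\<close>, whence the factor 2.
  The weight is kept general because it is used with \<open>cosh_weight\<close> and with a
  constant.\<close>

lemma derivative_abs_le_of_weighted_Lipschitz:
  fixes f :: "real \<Rightarrow> real"
  assumes d: "(f has_real_derivative D) (at x)" and W: "isCont W x"
    and le: "\<And>y. f y - f x \<le> M * (W y + W x) * \<bar>y - x\<bar>" "\<And>y. f x - f y \<le> M * (W y + W x) * \<bar>y - x\<bar>"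
  shows "\<bar>D\<bar> \<le> M * (2 * W x)"
proof -
  have "((\<lambda>h. (f (x + h) - f x) / h) \<longlongrightarrow> D) (at 0)" using d by (simp add: DERIV_def)
  then have 1: "((\<lambda>h. \<bar>(f (x + h) - f x) / h\<bar>) \<longlongrightarrow> \<bar>D\<bar>) (at 0)" by (rule tendsto_rabs)
  have "((\<lambda>h. W (x + h)) \<longlongrightarrow> W x) (at 0)" using W by (simp add: isCont_iff)
  then have 2: "((\<lambda>h. M * (W (x + h) + W x)) \<longlongrightarrow> M * (W x + W x)) (at 0)" by (intro tendsto_intros)
  have "\<bar>D\<bar> \<le> M * (W x + W x)"
  proof (rule tendsto_le[OF _ 2 1])
    have "\<bar>(f (x + h) - f x) / h\<bar> \<le> M * (W (x + h) + W x)" if "h \<noteq> 0" for h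
      using that le[of "x + h"] by (simp add: abs_divide pos_divide_le_eq abs_le_iff)
    then show "eventually (\<lambda>h. \<bar>(f (x + h) - f x) / h\<bar> \<le> M * (W (x + h) + W x)) (at 0)"
      by (auto simp: eventually_at_filter)
  qed simp
  then show ?thesis by simp
qed

section \<open>Propagation of exponential decay\<close>

definition nonlocal_term :: "(real \<Rightarrow> real) \<Rightarrow> (real \<Rightarrow> real) \<Rightarrow> (real \<Rightarrow> real) \<Rightarrow> real \<Rightarrow> real" where
  "nonlocal_term a b c x =
     conv G (\<lambda>y. a y * deriv b y + a y * deriv c y) x
     + conv Gx (\<lambda>y. fF (a y) (b y) (c y) (deriv a y) (deriv b y) (deriv c y)) x"

lemma CH_term_eq:
  "CH_term a b c t x = (a t x + b t x + c t x) * deriv (a t) x + nonlocal_term (a t) (b t) (c t) x"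
  by (simp add: CH_term_def nonlocal_term_def)

lemma abs_mult_bound:
  fixes p q :: real
  assumes "\<bar>p\<bar> \<le> B" "\<bar>q\<bar> \<le> M"
  shows "\<bar>p * q\<bar> \<le> B * M"
  unfolding abs_mult using assms by (intro mult_mono) auto

text \<open>In each product one factor is measured by \<open>B\<close> and the other by
  \<open>M\<close>, so the quadratic form is bounded linearly in \<open>M\<close>. Its coefficients
  have absolute sum 11/2, rounded up to 6.\<close>

lemma fF_bound:
  assumes "\<bar>a\<bar> \<le> B" "\<bar>b\<bar> \<le> B" "\<bar>c\<bar> \<le> B" "\<bar>ax\<bar> \<le> B" "\<bar>bx\<bar> \<le> B" "\<bar>cx\<bar> \<le> B"
    and "\<bar>a\<bar> \<le> M" "\<bar>b\<bar> \<le> M" "\<bar>c\<bar> \<le> M" "\<bar>ax\<bar> \<le> M" "\<bar>bx\<bar> \<le> M" "\<bar>cx\<bar> \<le> M"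
  shows "\<bar>fF a b c ax bx cx\<bar> \<le> 6 * B * M"
proof -
  have "\<bar>a * a\<bar> \<le> B * M" "\<bar>ax * ax\<bar> \<le> B * M" "\<bar>ax * bx\<bar> \<le> B * M" "\<bar>ax * cx\<bar> \<le> B * M"
    "\<bar>b * b\<bar> \<le> B * M" "\<bar>bx * bx\<bar> \<le> B * M" "\<bar>c * c\<bar> \<le> B * M" "\<bar>cx * cx\<bar> \<le> B * M"
    by (intro abs_mult_bound assms)+
  then show ?thesis unfolding fF_def power2_eq_square abs_le_iff by linarith
qed

text \<open>Each of the two integrands is at most 6BM times the weight, and the two convolutions
  together give 12. Size and Lipschitz bound share the factor 1 + \<open>G_const \<alpha>\<close>,
  so that a single constant enters the choice of \<mu>.\<close>

lemma nonlocal_term_bounds: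
  assumes \<alpha>: "0 < \<alpha>" "\<alpha> < 1" and \<epsilon>: "0 \<le> \<epsilon>" and B: "0 \<le> B"
    and d: "\<And>f x. f \<in> {a, b, c} \<Longrightarrow> (f has_real_derivative deriv f x) (at x)"
    and bd: "\<And>f x. f \<in> {a, b, c} \<Longrightarrow> \<bar>f x\<bar> \<le> B" "\<And>f x. f \<in> {a, b, c} \<Longrightarrow> \<bar>deriv f x\<bar> \<le> B"
    and M: "\<And>f x. f \<in> {a, b, c} \<Longrightarrow> \<bar>f x\<bar> \<le> M * cosh_weight \<alpha> \<epsilon> x"
      "\<And>f x. f \<in> {a, b, c} \<Longrightarrow> \<bar>deriv f x\<bar> \<le> M * cosh_weight \<alpha> \<epsilon> x"
  shows "\<bar>nonlocal_term a b c x\<bar> \<le> 12 * B * (1 + G_const \<alpha>) * M * cosh_weight \<alpha> \<epsilon> x"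
    and "\<bar>nonlocal_term a b c x - nonlocal_term a b c y\<bar> \<le>
      12 * B * (1 + G_const \<alpha>) * M * \<bar>x - y\<bar> * (cosh_weight \<alpha> \<epsilon> x + cosh_weight \<alpha> \<epsilon> y)"
proof -
  let ?W = "cosh_weight \<alpha> \<epsilon>"
  define F1 where "F1 y = a y * deriv b y + a y * deriv c y" for y
  define F2 where "F2 y = fF (a y) (b y) (c y) (deriv a y) (deriv b y) (deriv c y)" for y
  have cont: "continuous_on UNIV f" if "f \<in> {a, b, c}" for f
    using d[OF that] by (intro continuous_at_imp_continuous_on ballI DERIV_isCont) auto
  have [measurable]: "a \<in> borel_measurable borel" "b \<in> borel_measurable borel" "c \<in> borel_measurable borel"
    by (intro borel_measurable_continuous_onI cont, simp)+
  have [measurable]: "deriv a \<in> borel_measurable borel" "deriv b \<in> borel_measurable borel" "deriv c \<in> borel_measurable borel"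
    by (intro deriv_measurable d, simp)+
  have m1: "F1 \<in> borel_measurable borel" unfolding F1_def[abs_def] by measurable
  have m2: "F2 \<in> borel_measurable borel" unfolding F2_def[abs_def] fF_def by measurable
  have M0: "0 \<le> M"
    using M(1)[of a 0] cosh_weight_pos[OF \<epsilon>, of \<alpha> 0] by (smt (verit) mult_neg_pos insertCI)
  have b1: "\<bar>F1 y\<bar> \<le> (6 * B * M) * ?W y" for y
  proof -
    have "\<bar>a y * deriv b y\<bar> \<le> B * (M * ?W y)" "\<bar>a y * deriv c y\<bar> \<le> B * (M * ?W y)"
      by (rule abs_mult_bound[OF bd(1)[of a y] M(2)[of b y]] abs_mult_bound[OF bd(1)[of a y] M(2)[of c y]]; simp)+
    moreover have "0 \<le> B * (M * ?W y)"
      using B M0 cosh_weight_pos[OF \<epsilon>, of \<alpha> y] by simp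
    ultimately have "\<bar>F1 y\<bar> \<le> 6 * (B * (M * ?W y))" unfolding F1_def by linarith
    then show ?thesis by (simp add: mult_ac)
  qed
  have b2: "\<bar>F2 y\<bar> \<le> (6 * B * M) * ?W y" for y
  proof -
    have "\<bar>F2 y\<bar> \<le> 6 * B * (M * ?W y)"
      unfolding F2_def
      by (rule fF_bound[OF bd(1)[of a y] bd(1)[of b y] bd(1)[of c y] bd(2)[of a y] bd(2)[of b y] bd(2)[of c y]
        M(1)[of a y] M(1)[of b y] M(1)[of c y] M(2)[of a y] M(2)[of b y] M(2)[of c y]]) simp_all
    then show ?thesis by (simp add: mult_ac)
  qed
  have nt: "nonlocal_term a b c z = conv G F1 z + conv Gx F2 z" for z
    by (simp add: nonlocal_term_def F1_def[abs_def] F2_def[abs_def])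
  have Gabs: "\<bar>G z\<bar> \<le> G z" for z by simp
  have Gd: "\<bar>G p - G q\<bar> \<le> of_bool (p * q \<le> 0) + \<bar>p - q\<bar> * (G p + G q)" for p q
    using G_diff_le[of p q] by (rule order_trans) simp
  have W0: "0 \<le> ?W z" for z using cosh_weight_pos[OF \<epsilon>, of \<alpha> z] by simp
  have "\<bar>nonlocal_term a b c x\<bar> \<le> (6 * B * M) * (G_const \<alpha> * ?W x) + (6 * B * M) * (G_const \<alpha> * ?W x)"
    unfolding nt
    by (intro order_trans[OF abs_triangle_ineq] add_mono
      kernel_conv_bound(2)[OF \<alpha> \<epsilon> G_measurable m1 Gabs b1] kernel_conv_bound(2)[OF \<alpha> \<epsilon> Gx_measurable m2 Gx_abs_le b2])
  also have "\<dots> = 12 * B * M * ?W x * G_const \<alpha>" by simp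
  also have "\<dots> \<le> 12 * B * M * ?W x * (1 + G_const \<alpha>)"
    using B M0 W0 by (intro mult_left_mono) auto
  finally show "\<bar>nonlocal_term a b c x\<bar> \<le> 12 * B * (1 + G_const \<alpha>) * M * ?W x" by (simp add: algebra_simps)
  let ?D = "(6 * B * M) * ((1 + G_const \<alpha>) * \<bar>x - y\<bar> * (?W x + ?W y))"
  have "\<bar>conv G F1 x - conv G F1 y\<bar> \<le> ?D"
    by (rule kernel_conv_diff_bound[OF \<alpha> \<epsilon> G_measurable m1 Gabs b1 Gd])
  moreover have "\<bar>conv Gx F2 x - conv Gx F2 y\<bar> \<le> ?D"
    by (rule kernel_conv_diff_bound[OF \<alpha> \<epsilon> Gx_measurable m2 Gx_abs_le b2 Gx_diff_le])
  ultimately have "\<bar>nonlocal_term a b c x - nonlocal_term a b c y\<bar> \<le> ?D + ?D"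
    unfolding nt by linarith
  then show "\<bar>nonlocal_term a b c x - nonlocal_term a b c y\<bar> \<le>
      12 * B * (1 + G_const \<alpha>) * M * \<bar>x - y\<bar> * (?W x + ?W y)" by (simp add: algebra_simps)
qed

text \<open>Subtracting (C/\<mu>) exp(\<mu> t), a primitive of the bound, leaves a nonincreasing
  function. The factor 1/\<mu> is the gain obtained from a large \<mu>.\<close>

lemma growth_from_derivative_bound:
  fixes f :: "real \<Rightarrow> real"
  assumes d: "\<And>t. t \<in> {0..T} \<Longrightarrow> (f has_real_derivative f' t) (at t within {0..T})"
    and le: "\<And>t. t \<in> {0..T} \<Longrightarrow> \<bar>f' t\<bar> \<le> C * exp (\<mu> * t)"
    and \<mu>: "\<mu> > 0" and C: "C \<ge> 0" and t: "t \<in> {0..T}"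
  shows "\<bar>f t\<bar> \<le> \<bar>f 0\<bar> + C / \<mu> * exp (\<mu> * t)"
proof -
  have *: "g t \<le> g 0 + C / \<mu> * exp (\<mu> * t)"
    if d: "\<And>t. t \<in> {0..T} \<Longrightarrow> (g has_real_derivative g' t) (at t within {0..T})"
      and le: "\<And>t. t \<in> {0..T} \<Longrightarrow> g' t \<le> C * exp (\<mu> * t)" for g g' :: "real \<Rightarrow> real"
  proof -
    let ?h = "\<lambda>t. g t - C / \<mu> * exp (\<mu> * t)"
    have dh: "(?h has_real_derivative g' x - C * exp (\<mu> * x)) (at x within {0..T})" if "x \<in> {0..T}" for x
      using \<mu> by (auto intro!: derivative_eq_intros d[OF that])
    have "?h t \<le> ?h 0"
    proof (rule DERIV_nonpos_imp_decreasing_open[of 0 t ?h])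
      fix x assume x: "0 < x" "x < t"
      then have "at x within {0..T} = at x" using t by (intro at_within_interior) auto
      then show "\<exists>y. DERIV ?h x :> y \<and> y \<le> 0"
        using dh[of x] le[of x] x t by (intro exI[of _ "g' x - C * exp (\<mu> * x)"]) auto
    next
      show "continuous_on {0..t} ?h"
        using t by (intro continuous_on_subset[OF DERIV_continuous_on[OF dh]]) auto
    qed (use t in simp)
    moreover have "C / \<mu> * exp (\<mu> * 0) \<ge> 0" using C \<mu> by simp
    ultimately show ?thesis by linarith
  qed
  have "f t \<le> f 0 + C / \<mu> * exp (\<mu> * t)"
    using le by (intro *[OF d]) (auto simp: abs_le_iff)
  moreover have "- f t \<le> - f 0 + C / \<mu> * exp (\<mu> * t)"
    using le by (intro *[OF DERIV_minus[OF d]]) (auto simp: abs_le_iff)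
  ultimately show ?thesis by linarith
qed

text \<open>With C1 = 12 B (1 + \<open>G_const \<alpha>\<close>) the exponent is \<mu> = 18B + 4 C1
  + 4. Values need 2 (3B + C1) \<le> \<mu>, so that time integration returns at most S/2;
  derivatives need \<mu> - 6B > 4 C1 for the barrier, where 6B is twice the bound 3B of the
  transport speed. The summand 4 keeps \<mu> positive and the second inequality strict even if B =
  0.\<close>

lemma component_improvement:
  fixes a b c :: "real \<Rightarrow> real \<Rightarrow> real"
  assumes \<alpha>: "0 < \<alpha>" "\<alpha> < 1" and \<epsilon>: "0 < \<epsilon>" and B: "0 \<le> B" and K: "0 \<le> K" and S: "0 < S"
    and \<mu>: "\<mu> = 18 * B + 48 * B * (1 + G_const \<alpha>) + 4"
    and dx: "\<And>f t x. f \<in> {a, b, c} \<Longrightarrow> t \<in> {0..T} \<Longrightarrow> (f t has_real_derivative deriv (f t) x) (at x)"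
    and bd: "\<And>f t x. f \<in> {a, b, c} \<Longrightarrow> t \<in> {0..T} \<Longrightarrow> \<bar>f t x\<bar> \<le> B"
      "\<And>f t x. f \<in> {a, b, c} \<Longrightarrow> t \<in> {0..T} \<Longrightarrow> \<bar>deriv (f t) x\<bar> \<le> B"
    and lip: "\<And>f t x y. f \<in> {a, b, c} \<Longrightarrow> t \<in> {0..T} \<Longrightarrow> \<bar>f t x - f t y\<bar> \<le> B * \<bar>x - y\<bar>"
    and M: "\<And>f t x. f \<in> {a, b, c} \<Longrightarrow> t \<in> {0..T} \<Longrightarrow> \<bar>f t x\<bar> \<le> S * exp (\<mu> * t) * cosh_weight \<alpha> \<epsilon> x"
      "\<And>f t x. f \<in> {a, b, c} \<Longrightarrow> t \<in> {0..T} \<Longrightarrow> \<bar>deriv (f t) x\<bar> \<le> S * exp (\<mu> * t) * cosh_weight \<alpha> \<epsilon> x"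
    and dt: "\<And>t x. t \<in> {0..T} \<Longrightarrow>
      ((\<lambda>\<tau>. a \<tau> x) has_real_derivative - CH_term a b c t x) (at t within {0..T})"
    and init: "\<And>x. \<bar>a 0 x\<bar> \<le> K * exp (\<alpha> * x)" "\<And>x. \<bar>deriv (a 0) x\<bar> \<le> K * exp (\<alpha> * x)"
    and t: "t \<in> {0..T}"
  shows "\<bar>a t x\<bar> \<le> (2 * K + S / 2) * exp (\<mu> * t) * cosh_weight \<alpha> \<epsilon> x"
    and "\<bar>deriv (a t) x\<bar> \<le> (2 * K + S / 2) * exp (\<mu> * t) * cosh_weight \<alpha> \<epsilon> x"
proof -
  let ?W = "cosh_weight \<alpha> \<epsilon>"
  define C1 where "C1 = 12 * B * (1 + G_const \<alpha>)"
  define U where "U t x = a t x + b t x + c t x" for t x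
  define P where "P t = nonlocal_term (a t) (b t) (c t)" for t
  have G0: "0 \<le> G_const \<alpha>"
    using \<alpha> by (simp add: G_const_def power_le_one)
  have C1: "C1 \<ge> 0" unfolding C1_def using B G0 by simp
  have \<mu>C: "\<mu> = 18 * B + 4 * C1 + 4" unfolding \<mu> C1_def by simp
  have \<mu>0: "\<mu> > 0" unfolding \<mu>C using B C1 by simp
  have W0: "?W x > 0" for x using \<epsilon> by (intro cosh_weight_pos) auto
  have expW: "exp (\<alpha> * x) \<le> ?W x" for x using \<epsilon> by (simp add: cosh_weight_def)
  have P_bounds: "\<bar>P t x\<bar> \<le> C1 * (S * exp (\<mu> * t)) * ?W x"
    "\<bar>P t x - P t y\<bar> \<le> C1 * (S * exp (\<mu> * t)) * \<bar>x - y\<bar> * (?W x + ?W y)" if t: "t \<in> {0..T}" for t x y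
  proof -
    note nb = nonlocal_term_bounds[of \<alpha> \<epsilon> B "a t" "b t" "c t" "S * exp (\<mu> * t)"]
    have mem: "\<exists>f. g = f t \<and> f \<in> {a, b, c}" if "g \<in> {a t, b t, c t}" for g using that by auto
    show "\<bar>P t x\<bar> \<le> C1 * (S * exp (\<mu> * t)) * ?W x"
      "\<bar>P t x - P t y\<bar> \<le> C1 * (S * exp (\<mu> * t)) * \<bar>x - y\<bar> * (?W x + ?W y)"
      unfolding P_def C1_def
      by (rule nb; use \<alpha> \<epsilon> B mem dx[OF _ t] bd[OF _ t] M[OF _ t] in \<open>fastforce intro: less_imp_le\<close>)+
  qed
  have dt': "((\<lambda>\<tau>. a \<tau> x) has_real_derivative - (U t x * deriv (a t) x + P t x)) (at t within {0..T})"
    if "t \<in> {0..T}" for t x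
    using dt[OF that, of x] by (simp add: CH_term_eq U_def P_def)
  have U: "\<bar>U t x\<bar> \<le> 3 * B" if "t \<in> {0..T}" for t x
    using bd(1)[of a t x] bd(1)[of b t x] bd(1)[of c t x] that unfolding U_def by simp
  have Ulip: "\<bar>U t x - U t y\<bar> \<le> (3 * B) * \<bar>x - y\<bar>" if "t \<in> {0..T}" for t x y
    using lip[of a t x y] lip[of b t x y] lip[of c t x y] that unfolding U_def by simp
  have init_lip: "\<bar>a 0 x - a 0 y\<bar> \<le> K * \<bar>x - y\<bar> * (?W x + ?W y)" for x y
  proof -
    have *: "\<bar>a 0 y - a 0 x\<bar> \<le> K * \<bar>x - y\<bar> * (?W x + ?W y)" if "x < y" for x y
    proof -
      have d0: "(a 0 has_real_derivative deriv (a 0) z) (at z)" for z using dx[of a 0] t by auto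
      from MVT2[OF that, of "a 0" "deriv (a 0)"] d0 obtain z where z: "x < z" "z < y"
        and e: "a 0 y - a 0 x = (y - x) * deriv (a 0) z" by blast
      have "\<bar>deriv (a 0) z\<bar> \<le> K * exp (\<alpha> * z)" by (rule init)
      also have "\<dots> \<le> K * ?W z" using K expW by (rule mult_left_mono[rotated])
      also have "\<dots> \<le> K * (?W x + ?W y)"
        using \<alpha> \<epsilon> z K by (intro mult_left_mono cosh_weight_between) auto
      finally have "\<bar>y - x\<bar> * \<bar>deriv (a 0) z\<bar> \<le> \<bar>y - x\<bar> * (K * (?W x + ?W y))" by (rule mult_left_mono) simp
      then show ?thesis unfolding e abs_mult by (simp add: abs_minus_commute mult_ac)
    qed
    show ?thesis
      using *[of x y] *[of y x] by (cases x y rule: linorder_cases) (simp_all add: abs_minus_commute add.commute)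
  qed
  \<comment> \<open>Recovering a derivative from a weighted Lipschitz bound doubles the constant,
    and 2N is the required 2K + S/2.\<close>
  define N where "N = K + S / 4"
  have N: "0 < N" "K \<le> N" "C1 * S < N * (\<mu> - 2 * (3 * B))"
  proof -
    show "0 < N" "K \<le> N" using K S by (auto simp: N_def)
    have "C1 * S < (S / 4) * (4 * C1 + 4)" using S by (simp add: algebra_simps)
    also have "\<dots> \<le> N * (\<mu> - 2 * (3 * B))"
      using K S B C1 by (intro mult_mono) (auto simp: N_def \<mu>C)
    finally show "C1 * S < N * (\<mu> - 2 * (3 * B))" .
  qed
  have le: "a t x - a t y \<le> N * exp (\<mu> * t) * (?W x + ?W y) * \<bar>x - y\<bar>" for x y
  proof (rule sqrt_sum_squares_regularisation_limit)
    show "0 \<le> N * exp (\<mu> * t) * (?W x + ?W y)" using N W0[of x] W0[of y] by simp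
    fix \<delta> :: real assume \<delta>: "\<delta> > 0"
    show "a t x - a t y \<le> N * exp (\<mu> * t) * (?W x + ?W y) * sqrt ((x - y)\<^sup>2 + \<delta>\<^sup>2)"
    proof (rule transport_comparison_regularised[where a = a and ax = "\<lambda>t. deriv (a t)" and U = U and P = P
          and T = T and A = "3 * B" and B = B and Q = "C1 * S" and K = K])
      show "\<bar>P t x - P t y\<bar> \<le> C1 * S * exp (\<mu> * t) * \<bar>x - y\<bar> * (?W x + ?W y)" if "t \<in> {0..T}" for t x y
        using P_bounds(2)[OF that, of x y] by (simp add: mult.assoc)
    qed (use \<alpha> \<epsilon> \<delta> B \<mu>0 N K bd(1)[of a] lip[of a] dx[of a] dt' U Ulip init_lip t in auto)
  qed
  have "\<bar>deriv (a t) x\<bar> \<le> (N * exp (\<mu> * t)) * (2 * ?W x)"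
  proof (rule derivative_abs_le_of_weighted_Lipschitz[where f = "a t" and W = ?W])
    show "(a t has_real_derivative deriv (a t) x) (at x)" using dx[of a] t by simp
    show "isCont ?W x" by (rule DERIV_isCont[OF cosh_weight_deriv])
    show "a t y - a t x \<le> N * exp (\<mu> * t) * (?W y + ?W x) * \<bar>y - x\<bar>" for y by (rule le)
    show "a t x - a t y \<le> N * exp (\<mu> * t) * (?W y + ?W x) * \<bar>y - x\<bar>" for y
      using le[of x y] by (simp add: abs_minus_commute add.commute)
  qed
  then show "\<bar>deriv (a t) x\<bar> \<le> (2 * K + S / 2) * exp (\<mu> * t) * ?W x"
    by (simp add: N_def algebra_simps)
  have "\<bar>a t x\<bar> \<le> \<bar>a 0 x\<bar> + ((3 * B + C1) * S * ?W x) / \<mu> * exp (\<mu> * t)"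
  proof (rule growth_from_derivative_bound[OF dt' _ \<mu>0 _ t])
    show "0 \<le> (3 * B + C1) * S * ?W x" using B C1 S W0[of x] by simp
    fix s assume s: "s \<in> {0..T}"
    have "\<bar>U s x * deriv (a s) x\<bar> \<le> (3 * B) * (S * exp (\<mu> * s) * ?W x)"
      using U[OF s, of x] M(2)[of a s x] s by (intro abs_mult_bound) auto
    then have "\<bar>- (U s x * deriv (a s) x + P s x)\<bar> \<le> (3 * B) * (S * exp (\<mu> * s) * ?W x) + C1 * (S * exp (\<mu> * s)) * ?W x"
      using P_bounds(1)[OF s, of x] by linarith
    then show "\<bar>- (U s x * deriv (a s) x + P s x)\<bar> \<le> (3 * B + C1) * S * ?W x * exp (\<mu> * s)"
      by (simp add: algebra_simps)
  qed
  also have "\<dots> \<le> K * (exp (\<mu> * t) * ?W x) + S / 2 * (exp (\<mu> * t) * ?W x)"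
  proof (rule add_mono)
    have "\<bar>a 0 x\<bar> \<le> K * exp (\<alpha> * x)" by (rule init)
    also have "\<dots> \<le> K * (exp (\<mu> * t) * ?W x)"
    proof -
      have "1 * exp (\<alpha> * x) \<le> exp (\<mu> * t) * ?W x"
        using t \<mu>0 expW[of x] by (intro mult_mono) auto
      then show ?thesis using K by (simp add: mult_left_mono)
    qed
    finally show "\<bar>a 0 x\<bar> \<le> K * (exp (\<mu> * t) * ?W x)" .
    have "(3 * B + C1) / \<mu> \<le> 1 / 2" using \<mu>0 B C1 by (simp add: \<mu>C field_simps)
    then have "(3 * B + C1) / \<mu> * (S * (exp (\<mu> * t) * ?W x)) \<le> 1 / 2 * (S * (exp (\<mu> * t) * ?W x))"
      using S W0[of x] by (intro mult_right_mono) auto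
    then show "(3 * B + C1) * S * ?W x / \<mu> * exp (\<mu> * t) \<le> S / 2 * (exp (\<mu> * t) * ?W x)"
      by (simp add: mult_ac)
  qed
  also have "\<dots> \<le> (2 * K + S / 2) * exp (\<mu> * t) * ?W x"
    using K W0[of x] by (simp add: algebra_simps)
  finally show "\<bar>a t x\<bar> \<le> (2 * K + S / 2) * exp (\<mu> * t) * ?W x" .
qed

section \<open>Global constants for the initial data and the iteration\<close>

lemma exp_decay_left_global:
  assumes "exp_decay_left \<alpha> F" and \<alpha>: "0 \<le> \<alpha>" and bd: "\<And>x. \<bar>F x\<bar> \<le> B"
  shows "\<exists>K\<ge>0. \<forall>x. \<bar>F x\<bar> \<le> K * exp (\<alpha> * x)"
proof -
  obtain K M where K: "\<And>x. x \<le> M \<Longrightarrow> \<bar>F x\<bar> \<le> K * exp (\<alpha> * x)"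
    using assms(1) unfolding exp_decay_left_def by blast
  have B: "B \<ge> 0" using bd[of 0] by linarith
  \<comment> \<open>For x > M the second summand times exp(\<alpha> x) is at least \<open>B\<close>,
    because exp(\<alpha> (x - M)) \<ge> 1. The absolute value appears because
    \<open>exp_decay_left\<close> imposes no sign on its constant.\<close>
  define K' where "K' = \<bar>K\<bar> + B * exp (- (\<alpha> * M))"
  have "\<bar>F x\<bar> \<le> K' * exp (\<alpha> * x)" for x
  proof (cases "x \<le> M")
    case True
    have "K \<le> K'" using B by (simp add: K'_def add_increasing2)
    then show ?thesis using K[OF True] by (meson exp_ge_zero mult_right_mono order_trans)
  next
    case False
    have "\<bar>F x\<bar> \<le> B * 1" using bd by simp
    also have "\<dots> \<le> B * exp (- (\<alpha> * M) + \<alpha> * x)"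
      using B \<alpha> False by (intro mult_left_mono) (auto simp: mult_left_mono)
    also have "\<dots> = B * exp (- (\<alpha> * M)) * exp (\<alpha> * x)"
      by (simp only: exp_add mult.assoc)
    also have "\<dots> \<le> K' * exp (\<alpha> * x)"
      by (intro mult_right_mono) (simp_all add: K'_def)
    finally show ?thesis .
  qed
  moreover have "K' \<ge> 0" using B by (simp add: K'_def)
  ultimately show ?thesis by blast
qed

lemma common_constant:
  fixes g :: "'a \<Rightarrow> real"
  assumes "finite I" and K: "\<And>F. F \<in> I \<Longrightarrow> \<exists>K\<ge>0. \<forall>x. \<bar>F x\<bar> \<le> K * g x" and g: "\<And>x. g x \<ge> 0"
  obtains K where "K \<ge> 0" and "\<And>F x. F \<in> I \<Longrightarrow> \<bar>F x\<bar> \<le> K * g x"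
proof -
  from K obtain k where k: "\<And>F. F \<in> I \<Longrightarrow> k F \<ge> 0" "\<And>F x. F \<in> I \<Longrightarrow> \<bar>F x\<bar> \<le> k F * g x"
    by metis
  show thesis
  proof (rule that[of "sum k I"])
    show "sum k I \<ge> 0" using k by (intro sum_nonneg)
    fix F x assume F: "F \<in> I"
    have "k F * g x \<le> sum k I * g x"
      using assms(1) F k g by (intro mult_right_mono member_le_sum) auto
    with k(2)[OF F] show "\<bar>F x\<bar> \<le> sum k I * g x" by (rule order_trans)
  qed
qed

theorem theorem3p1:
  fixes s T \<alpha> :: real
    and u0 v0 w0 :: "real \<Rightarrow> real"
    and u v w :: "real \<Rightarrow> real \<Rightarrow> real"
  assumes "s > 3/2" and "T > 0"
    and "in_Hs s u0" and "in_Hs s v0" and "in_Hs s w0"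
    and "in_C_Hs s T u" and "in_C_Hs s T v" and "in_C_Hs s T w"
    and "CH3_solution T u v w u0 v0 w0"
    and "0 < \<alpha>" and "\<alpha> < 1"
    and "exp_decay_left \<alpha> u0" and "exp_decay_left \<alpha> v0" and "exp_decay_left \<alpha> w0"
    and "exp_decay_left \<alpha> (deriv u0)" and "exp_decay_left \<alpha> (deriv v0)"
    and "exp_decay_left \<alpha> (deriv w0)"
  shows "exp_decay_left_unif T \<alpha> u \<and> exp_decay_left_unif T \<alpha> v \<and> exp_decay_left_unif T \<alpha> w \<and>
         exp_decay_left_unif T \<alpha> (\<lambda>t. deriv (u t)) \<and> exp_decay_left_unif T \<alpha> (\<lambda>t. deriv (v t)) \<and>
         exp_decay_left_unif T \<alpha> (\<lambda>t. deriv (w t))"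
proof -
  let ?I = "{u, v, w}"
  note T = \<open>T > 0\<close> and \<alpha> = \<open>0 < \<alpha>\<close> \<open>\<alpha> < 1\<close>
  have sol0: "u 0 = u0" "v 0 = v0" "w 0 = w0"
    and diff: "\<And>t x. t \<in> {0..T} \<Longrightarrow> u t differentiable at x \<and> v t differentiable at x \<and> w t differentiable at x"
    and dt: "\<And>t x. t \<in> {0..T} \<Longrightarrow> ((\<lambda>\<tau>. u \<tau> x) has_real_derivative (- CH_term u v w t x)) (at t within {0..T})"
      "\<And>t x. t \<in> {0..T} \<Longrightarrow> ((\<lambda>\<tau>. v \<tau> x) has_real_derivative (- CH_term v u w t x)) (at t within {0..T})"
      "\<And>t x. t \<in> {0..T} \<Longrightarrow> ((\<lambda>\<tau>. w \<tau> x) has_real_derivative (- CH_term w u v t x)) (at t within {0..T})"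
    using \<open>CH3_solution T u v w u0 v0 w0\<close> unfolding CH3_solution_def by blast+
  have dx: "(f t has_real_derivative deriv (f t) x) (at x)" if "f \<in> ?I" "t \<in> {0..T}" for f t x
    using that diff[OF that(2), of x] by (auto simp: DERIV_deriv_iff_real_differentiable)
  have "\<exists>B\<ge>0. \<forall>t\<in>{0..T}. \<forall>x y. \<bar>f t x\<bar> \<le> B \<and> \<bar>f t x - f t y\<bar> \<le> B * \<bar>x - y\<bar>" if f: "f \<in> ?I" for f
  proof -
    have "in_C_Hs s T f" using f \<open>in_C_Hs s T u\<close> \<open>in_C_Hs s T v\<close> \<open>in_C_Hs s T w\<close> by auto
    from in_C_Hs_uniform_bounds[OF \<open>s > 3/2\<close> this DERIV_isCont[OF dx[OF f]]] show ?thesis by metis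
  qed
  then obtain \<beta> where \<beta>0: "\<And>f. f \<in> ?I \<Longrightarrow> \<beta> f \<ge> 0"
    and \<beta>: "\<And>f t x y. f \<in> ?I \<Longrightarrow> t \<in> {0..T} \<Longrightarrow> \<bar>f t x\<bar> \<le> \<beta> f \<and> \<bar>f t x - f t y\<bar> \<le> \<beta> f * \<bar>x - y\<bar>"
    by metis
  define B where "B = sum \<beta> ?I"
  have B: "B \<ge> 0" unfolding B_def using \<beta>0 by (intro sum_nonneg)
  have \<beta>B: "\<beta> f \<le> B" if "f \<in> ?I" for f unfolding B_def using that \<beta>0 by (intro member_le_sum) auto
  have bd: "\<bar>f t x\<bar> \<le> B" and lip: "\<bar>f t x - f t y\<bar> \<le> B * \<bar>x - y\<bar>"
    if "f \<in> ?I" "t \<in> {0..T}" for f t x y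
    using \<beta>[OF that, of x y] \<beta>B[OF that(1)] mult_right_mono[OF \<beta>B[OF that(1)], of "\<bar>x - y\<bar>"] by auto
  have dbd: "\<bar>deriv (f t) x\<bar> \<le> B" if "f \<in> ?I" "t \<in> {0..T}" for f t x
  proof -
    \<comment> \<open>The weight 1/2 makes the sum of the two endpoint weights equal to 1, so an
      ordinary Lipschitz bound fits the weighted lemma.\<close>
    have "\<bar>deriv (f t) x\<bar> \<le> B * (2 * (1 / 2))"
    proof (rule derivative_abs_le_of_weighted_Lipschitz[where f = "f t" and W = "\<lambda>_. 1 / 2", OF dx[OF that]])
      show "f t y - f t x \<le> B * (1 / 2 + 1 / 2) * \<bar>y - x\<bar>" for y
        using lip[OF that, of y x] by simp
      show "f t x - f t y \<le> B * (1 / 2 + 1 / 2) * \<bar>y - x\<bar>" for y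
        using lip[OF that, of y x] by simp
    qed simp
    then show ?thesis by simp
  qed
  have 0: "0 \<in> {0..T}" using T by simp
  let ?J = "{u0, v0, w0, deriv u0, deriv v0, deriv w0}"
  have "\<exists>K\<ge>0. \<forall>x. \<bar>F x\<bar> \<le> K * exp (\<alpha> * x)" if "F \<in> ?J" for F
  proof (rule exp_decay_left_global)
    show "exp_decay_left \<alpha> F" using that assms by auto
    show "\<bar>F x\<bar> \<le> B" for x
      using that bd[OF _ 0, of _ x] dbd[OF _ 0, of _ x] sol0 by force
  qed (use \<alpha> in simp)
  then obtain K where K: "K \<ge> 0" and KF: "\<And>F x. F \<in> ?J \<Longrightarrow> \<bar>F x\<bar> \<le> K * exp (\<alpha> * x)"
    using common_constant[of ?J "\<lambda>x. exp (\<alpha> * x)"] by (metis finite.emptyI finite_insert exp_ge_zero)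
  have init: "\<bar>f 0 x\<bar> \<le> K * exp (\<alpha> * x)" "\<bar>deriv (f 0) x\<bar> \<le> K * exp (\<alpha> * x)" if "f \<in> ?I" for f x
    using that KF[of "f 0" x] KF[of "deriv (f 0)" x] sol0 by auto
  define \<mu> where "\<mu> = 18 * B + 48 * B * (1 + G_const \<alpha>) + 4"
  have \<mu>: "\<mu> \<ge> 0"
    using B \<alpha> unfolding \<mu>_def G_const_def by (simp add: power_le_one)
  define valid where "valid \<epsilon> S \<longleftrightarrow> (\<forall>f\<in>?I. \<forall>t\<in>{0..T}. \<forall>x.
      \<bar>f t x\<bar> \<le> S * exp (\<mu> * t) * cosh_weight \<alpha> \<epsilon> x \<and>
      \<bar>deriv (f t) x\<bar> \<le> S * exp (\<mu> * t) * cosh_weight \<alpha> \<epsilon> x)" for \<epsilon> S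
  have improve: "valid \<epsilon> (2 * K + S / 2)" if \<epsilon>: "\<epsilon> > 0" and S: "S > 0" and valid: "valid \<epsilon> S" for \<epsilon> S
  proof -
    \<comment> \<open>The three equations differ only in which component comes first; the set
      equation lets one argument serve every such permutation.\<close>
    have step: "\<bar>a t x\<bar> \<le> (2 * K + S / 2) * exp (\<mu> * t) * cosh_weight \<alpha> \<epsilon> x \<and>
        \<bar>deriv (a t) x\<bar> \<le> (2 * K + S / 2) * exp (\<mu> * t) * cosh_weight \<alpha> \<epsilon> x"
      if I: "{a, b, c} = ?I" and t: "t \<in> {0..T}"
        and dta: "\<And>t x. t \<in> {0..T} \<Longrightarrow> ((\<lambda>\<tau>. a \<tau> x) has_real_derivative - CH_term a b c t x) (at t within {0..T})"
      for a b c t x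
    proof -
      have a: "a \<in> ?I" using I by blast
      have M: "\<bar>f t x\<bar> \<le> S * exp (\<mu> * t) * cosh_weight \<alpha> \<epsilon> x"
        "\<bar>deriv (f t) x\<bar> \<le> S * exp (\<mu> * t) * cosh_weight \<alpha> \<epsilon> x" if "f \<in> ?I" "t \<in> {0..T}" for f t x
        using valid that unfolding valid_def by blast+
      show ?thesis
        using component_improvement[OF \<alpha> \<epsilon> B K S \<mu>_def, of a b c T t x, unfolded I]
          dx bd dbd lip M dta init[OF a] t by simp
    qed
    show ?thesis
      unfolding valid_def
      using step[of u v w, OF _ _ dt(1)] step[of v u w, OF _ _ dt(2)] step[of w u v, OF _ _ dt(3)]
      by (auto simp: insert_commute)
  qed
  have limit: "valid \<epsilon> (4 * K)" if \<epsilon>: "\<epsilon> > 0" for \<epsilon>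
  proof -
    \<comment> \<open>The weight is at least min 1 \<epsilon>, so this \<open>S\<close> dominates
      the bound \<open>B\<close>; the added 1 makes it positive when B = 0. Its blow-up as
      \<epsilon> \<rightarrow> 0 does no harm, since the iteration removes it.\<close>
    define S where "S = (B + 1) / min 1 \<epsilon>"
    have S: "S > 0" using B \<epsilon> by (simp add: S_def)
    have "B \<le> S * exp (\<mu> * t) * cosh_weight \<alpha> \<epsilon> x" if "t \<in> {0..T}" for t x
    proof -
      have "B \<le> S * 1 * min 1 \<epsilon>" using \<epsilon> by (simp add: S_def)
      also have "\<dots> \<le> S * exp (\<mu> * t) * cosh_weight \<alpha> \<epsilon> x"
        using S \<mu> \<epsilon> that by (intro mult_mono cosh_weight_ge_const) auto
      finally show ?thesis .
    qed
    then have "valid \<epsilon> S"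
      unfolding valid_def using bd dbd by (meson order_trans)
    \<comment> \<open>The map S \<mapsto> 2K + S/2 has fixed point 4K and halves the distance to it.
      Starting at 4K + S, a weaker bound than \<open>S\<close>, gives this closed form.\<close>
    then have it: "valid \<epsilon> (4 * K + S / 2 ^ n)" for n
    proof (induction n)
      case 0
      then show ?case
        using K order_trans unfolding valid_def
        by (smt (verit) \<epsilon> cosh_weight_pos div_by_1 exp_gt_zero mult_right_mono mult_nonneg_nonneg power_0)
    next
      case (Suc n)
      have "4 * K + S / 2 ^ n > 0" using K S by (simp add: add_nonneg_pos)
      from improve[OF \<epsilon> this Suc.IH[OF Suc.prems]]
      have "valid \<epsilon> (2 * K + (4 * K + S / 2 ^ n) / 2)" .
      also have "2 * K + (4 * K + S / 2 ^ n) / 2 = 4 * K + S / 2 ^ Suc n" by (simp add: field_simps)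
      finally show ?case .
    qed
    have "(\<lambda>n. (4 * K + S / 2 ^ n) * exp (\<mu> * t) * cosh_weight \<alpha> \<epsilon> x) \<longlonglongrightarrow>
        (4 * K + 0) * exp (\<mu> * t) * cosh_weight \<alpha> \<epsilon> x" for t x
      by (intro tendsto_intros LIMSEQ_divide_realpow_zero) simp
    note lim = LIMSEQ_le_const[OF this]
    show ?thesis
      unfolding valid_def
    proof (intro ballI allI conjI)
      fix f t x assume f: "f \<in> ?I" and t: "t \<in> {0..T}"
      have n: "\<bar>f t x\<bar> \<le> (4 * K + S / 2 ^ n) * exp (\<mu> * t) * cosh_weight \<alpha> \<epsilon> x"
        "\<bar>deriv (f t) x\<bar> \<le> (4 * K + S / 2 ^ n) * exp (\<mu> * t) * cosh_weight \<alpha> \<epsilon> x" for n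
        using it[of n] f t unfolding valid_def by blast+
      show "\<bar>f t x\<bar> \<le> 4 * K * exp (\<mu> * t) * cosh_weight \<alpha> \<epsilon> x"
        using lim[of "\<bar>f t x\<bar>" t x] n(1) by simp
      show "\<bar>deriv (f t) x\<bar> \<le> 4 * K * exp (\<mu> * t) * cosh_weight \<alpha> \<epsilon> x"
        using lim[of "\<bar>deriv (f t) x\<bar>" t x] n(2) by simp
    qed
  qed
  have final: "\<bar>f t x\<bar> \<le> (4 * K * exp (\<mu> * T)) * exp (\<alpha> * x) \<and>
      \<bar>deriv (f t) x\<bar> \<le> (4 * K * exp (\<mu> * T)) * exp (\<alpha> * x)"
    if f: "f \<in> ?I" and t: "t \<in> {0..T}" for f t x
  proof -
    \<comment> \<open>At fixed t and x only the weight still depends on \<epsilon>, so the limit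
      removes the term growing at minus infinity. Uniformity in time then comes from exp(\<mu> t)
      \<le> exp(\<mu> T).\<close>
    have lim: "((\<lambda>\<epsilon>. 4 * K * exp (\<mu> * t) * cosh_weight \<alpha> \<epsilon> x) \<longlongrightarrow>
        4 * K * exp (\<mu> * t) * cosh_weight \<alpha> 0 x) (at_right 0)"
      unfolding cosh_weight_def by (intro tendsto_intros)
    have "4 * K * exp (\<mu> * t) * cosh_weight \<alpha> 0 x \<le> 4 * K * exp (\<mu> * T) * exp (\<alpha> * x)"
      unfolding cosh_weight_def using K t \<mu> by (auto intro!: mult_left_mono mult_right_mono)
    moreover have "\<bar>f t x\<bar> \<le> 4 * K * exp (\<mu> * t) * cosh_weight \<alpha> 0 x"
      by (rule tendsto_lowerbound[OF lim])
        (use limit f t in \<open>auto simp: valid_def eventually_at_filter\<close>)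
    moreover have "\<bar>deriv (f t) x\<bar> \<le> 4 * K * exp (\<mu> * t) * cosh_weight \<alpha> 0 x"
      by (rule tendsto_lowerbound[OF lim])
        (use limit f t in \<open>auto simp: valid_def eventually_at_filter\<close>)
    ultimately show ?thesis by linarith
  qed
  have "exp_decay_left_unif T \<alpha> f \<and> exp_decay_left_unif T \<alpha> (\<lambda>t. deriv (f t))" if "f \<in> ?I" for f
    unfolding exp_decay_left_unif_def using final[OF that] by blast
  then show ?thesis by blast
qed

end
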